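(* Let $a$ and $k$ be non-zero complex numbers and let $q$ be a non-zero complex number such that $|q|<\min\{1,|a/k|,|k/a|\}$. Let $(\alpha_n(a,k),\beta_n(a,k))$ be a WP-Bailey pair (the defining relation holding both at the parameters $(a,k,q)$ and at $(1/a,1/k,q)$), and let $F(a,k,q)$ be the function defined in the context; $F(1/a,1/k,q)$ is obtained by replacing $a$ by $1/a$ and $k$ by $1/k$ everywhere, including in $\alpha_n$ and $\beta_n$. Assume that none of the denominators occurring vanish and that all the series occurring in $F(a,k,q)$ and $F(1/a,1/k,q)$ converge. Then $$ \begin{aligned} F(a,k,q)-F\left(\frac1a,\frac1k,q\right) ={}&\frac{aq}{k^2}\,\frac{\left(aq,\,q/a,\,k^2/a,\,q^2a/k^2,\,k^2/q,\,q^3/k^2,\,q^2,\,q^2;q^2\right)_\infty}{\left(aq/k^2,\,k^2q/a,\,a,\,q^2/a,\,k^2,\,q^2/k^2,\,q,\,q;q^2\right)_\infty}\\ &-\frac{a}{k}\,\frac{\left(k^2/a,\,qa/k^2,\,-a,\,-q/a;q\right)_\infty\,(q^2,q^2;q^2)_\infty}{\left(k^2,\,q^2/k^2,\,a^2/k^2,\,q^2k^2/a^2;q^2\right)_\infty} +\frac{(a^2-k)(a-k^2)}{(1-a)(1-k)(a^2-k^2)}. \end{aligned} $$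
   Context: Notation: $(x;q)_0=1$, $(x;q)_n=\prod_{i=0}^{n-1}(1-xq^i)$, $(x;q)_\infty=\prod_{i\ge 0}(1-xq^i)$ for $|q|<1$, and $(x_1,\dots,x_r;q)_n=\prod_{i=1}^r(x_i;q)_n$ (also for $n=\infty$). A WP-Bailey pair is a pair of sequences $(\alpha_n(a,k,q),\beta_n(a,k,q))_{n\ge0}$ of functions of the parameters with $\alpha_0=\beta_0=1$ and, for $n>0$, $$\beta_n(a,k,q)=\sum_{j=0}^n\frac{(k/a;q)_{n-j}(k;q)_{n+j}}{(q;q)_{n-j}(aq;q)_{n+j}}\,\alpha_j(a,k,q).$$ The dependence on $q$ is often suppressed: $\alpha_n(a,k)=\alpha_n(a,k,q)$, $\beta_n(a,k)=\beta_n(a,k,q)$. For a WP-Bailey pair define $$ \begin{aligned} F(a,k,q):={}&\sum_{n=1}^\infty\frac{(1-kq^{2n})(q;q)_{n-1}(k^2/a;q)_n(qa;q^2)_n}{(1-k)(qa/k,\,kq;q)_n(k^2q/a;q^2)_n}\left(\frac{-qa}{k}\right)^n\beta_n(a,k)\\ &-\sum_{n=1}^\infty\frac{(q^2;q^2)_{n-1}(k^2/a;q^2)_n}{(q^2a^2/k^2,\,q^2a;q^2)_n}\left(\frac{qa}{k}\right)^{2n}\alpha_{2n}(a,k)\\ &+\frac{\left(k^2/a,\,q^3a^2/k^2,\,q^3a,\,q^2;q^2\right)_\infty}{\left(k^2q/a,\,q^2a^2/k^2,\,q^2a,\,q;q^2\right)_\infty}\sum_{n=0}^\infty\frac{(k^2q/a,\,q;q^2)_n}{(q^3a^2/k^2,\,q^3a;q^2)_n}\left(\frac{qa}{k}\right)^{2n+1}\alpha_{2n+1}(a,k).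 \end{aligned} $$ *)

theory Defs
  imports "HOL-Analysis.Analysis"
begin

text \<open>
  The q-shifted factorials: \<open>qpoch x q n\<close> is \<open>(x;q)\<^sub>n\<close>, and \<open>qpoch_inf x q\<close> is
  \<open>(x;q)\<^sub>\<infinity>\<close>, to be used for \<open>\<bar>q\<bar> < 1\<close> only. The list versions are
  \<open>(x\<^sub>1, \<dots>, x\<^sub>r; q)\<^sub>n\<close> and \<open>(x\<^sub>1, \<dots>, x\<^sub>r; q)\<^sub>\<infinity>\<close>.
\<close>

definition qpoch :: "complex \<Rightarrow> complex \<Rightarrow> nat \<Rightarrow> complex" where
  "qpoch x q n = (\<Prod>i<n. 1 - x * q ^ i)"

definition qpoch_inf :: "complex \<Rightarrow> complex \<Rightarrow> complex" where
  "qpoch_inf x q = (\<Prod>i. 1 - x * q ^ i)"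

definition qpochs :: "complex list \<Rightarrow> complex \<Rightarrow> nat \<Rightarrow> complex" where
  "qpochs xs q n = (\<Prod>x\<leftarrow>xs. qpoch x q n)"

definition qpochs_inf :: "complex list \<Rightarrow> complex \<Rightarrow> complex" where
  "qpochs_inf xs q = (\<Prod>x\<leftarrow>xs. qpoch_inf x q)"

text \<open>
  \<open>\<alpha> n a k q\<close> stands for \<open>\<alpha>\<^sub>n(a,k,q)\<close>, so that a pair consists of two sequences of functions of
  the parameters; \<open>WP_Bailey_pair_at\<close> expresses the defining relation at one parameter point.
\<close>

type_synonym param_seq = "nat \<Rightarrow> complex \<Rightarrow> complex \<Rightarrow> complex \<Rightarrow> complex"

definition WP_Bailey_pair_at ::
    "param_seq \<Rightarrow> param_seq \<Rightarrow> complex \<Rightarrow> complex \<Rightarrow> complex \<Rightarrow> bool" where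
  "WP_Bailey_pair_at \<alpha> \<beta> a k q \<longleftrightarrow>
     \<alpha> 0 a k q = 1 \<and> \<beta> 0 a k q = 1 \<and>
     (\<forall>n>0. \<beta> n a k q =
        (\<Sum>j=0..n. (qpoch (k / a) q (n - j) * qpoch k q (n + j)) /
                   (qpoch q q (n - j) * qpoch (a * q) q (n + j)) * \<alpha> j a k q))"

definition WP_Bailey_denoms_nonzero :: "complex \<Rightarrow> complex \<Rightarrow> bool" where
  "WP_Bailey_denoms_nonzero a q \<longleftrightarrow> (\<forall>n. qpoch q q n \<noteq> 0 \<and> qpoch (a * q) q n \<noteq> 0)"

text \<open>The terms of the three series in \<open>F(a,k,q)\<close>; the first two series start at \<open>n = 1\<close>.\<close>

definition F_term\<beta> :: "param_seq \<Rightarrow> complex \<Rightarrow> complex \<Rightarrow> complex \<Rightarrow> nat \<Rightarrow> complex" where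
  "F_term\<beta> \<beta> a k q n =
     ((1 - k * q ^ (2 * n)) * qpoch q q (n - 1) * qpoch (k\<^sup>2 / a) q n * qpoch (q * a) (q\<^sup>2) n) /
     ((1 - k) * qpochs [q * a / k, k * q] q n * qpoch (k\<^sup>2 * q / a) (q\<^sup>2) n) *
     (- q * a / k) ^ n * \<beta> n a k q"

definition F_term_even :: "param_seq \<Rightarrow> complex \<Rightarrow> complex \<Rightarrow> complex \<Rightarrow> nat \<Rightarrow> complex" where
  "F_term_even \<alpha> a k q n =
     (qpoch (q\<^sup>2) (q\<^sup>2) (n - 1) * qpoch (k\<^sup>2 / a) (q\<^sup>2) n) /
     qpochs [q\<^sup>2 * a\<^sup>2 / k\<^sup>2, q\<^sup>2 * a] (q\<^sup>2) n *
     (q * a / k) ^ (2 * n) * \<alpha> (2 * n) a k q"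

definition F_term_odd :: "param_seq \<Rightarrow> complex \<Rightarrow> complex \<Rightarrow> complex \<Rightarrow> nat \<Rightarrow> complex" where
  "F_term_odd \<alpha> a k q n =
     qpochs [k\<^sup>2 * q / a, q] (q\<^sup>2) n /
     qpochs [q ^ 3 * a\<^sup>2 / k\<^sup>2, q ^ 3 * a] (q\<^sup>2) n *
     (q * a / k) ^ (2 * n + 1) * \<alpha> (2 * n + 1) a k q"

definition F :: "param_seq \<Rightarrow> param_seq \<Rightarrow> complex \<Rightarrow> complex \<Rightarrow> complex \<Rightarrow> complex" where
  "F \<alpha> \<beta> a k q =
     (\<Sum>n. F_term\<beta> \<beta> a k q (n + 1))
     - (\<Sum>n. F_term_even \<alpha> a k q (n + 1))
     + qpochs_inf [k\<^sup>2 / a, q ^ 3 * a\<^sup>2 / k\<^sup>2, q ^ 3 * a, q\<^sup>2] (q\<^sup>2) /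
       qpochs_inf [k\<^sup>2 * q / a, q\<^sup>2 * a\<^sup>2 / k\<^sup>2, q\<^sup>2 * a, q] (q\<^sup>2) *
       (\<Sum>n. F_term_odd \<alpha> a k q n)"

definition F_series_converge ::
    "param_seq \<Rightarrow> param_seq \<Rightarrow> complex \<Rightarrow> complex \<Rightarrow> complex \<Rightarrow> bool" where
  "F_series_converge \<alpha> \<beta> a k q \<longleftrightarrow>
     summable (\<lambda>n. F_term\<beta> \<beta> a k q (n + 1)) \<and>
     summable (\<lambda>n. F_term_even \<alpha> a k q (n + 1)) \<and>
     summable (F_term_odd \<alpha> a k q)"

definition F_denoms_nonzero :: "complex \<Rightarrow> complex \<Rightarrow> complex \<Rightarrow> bool" where
  "F_denoms_nonzero a k q \<longleftrightarrow>
     1 - k \<noteq> 0 \<and>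
     (\<forall>n. qpochs [q * a / k, k * q] q n \<noteq> 0) \<and>
     (\<forall>n. qpoch (k\<^sup>2 * q / a) (q\<^sup>2) n \<noteq> 0) \<and>
     (\<forall>n. qpochs [q\<^sup>2 * a\<^sup>2 / k\<^sup>2, q\<^sup>2 * a] (q\<^sup>2) n \<noteq> 0) \<and>
     qpochs_inf [k\<^sup>2 * q / a, q\<^sup>2 * a\<^sup>2 / k\<^sup>2, q\<^sup>2 * a, q] (q\<^sup>2) \<noteq> 0 \<and>
     (\<forall>n. qpochs [q ^ 3 * a\<^sup>2 / k\<^sup>2, q ^ 3 * a] (q\<^sup>2) n \<noteq> 0)"

end

theory Submission
  imports Defs "HOL-Complex_Analysis.Complex_Analysis"
begin

text \<open>
  Inserting the defining relation of the pair into the \<open>\<beta>\<close>-series and interchanging the sums, the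
  coefficient of \<open>\<alpha>\<^sub>j\<close> for \<open>j \<ge> 1\<close> is a very-well-poised series summable by the Gasper--Rahman
  \<open>q\<close>-analogue of Watson's theorem; it cancels against the \<open>\<alpha>\<close>-series in \<open>F\<close>. Hence \<open>F(a,k,q)\<close> is the
  coefficient of \<open>\<alpha>\<^sub>0\<close>. That coefficient is a limit case of the same summation, namely the
  logarithmic derivative of its product side at \<open>x = 1\<close>, and so a combination of Lambert series.
  In the difference \<open>F(a,k,q) - F(1/a,1/k,q)\<close> these combine into logarithmic derivatives of theta
  functions, and two instances of the four-term identity for these (in base \<open>q\<^sup>2\<close> and in base \<open>q\<close>)
  turn them into the two products on the right-hand side.
\<close>

subsection \<open>\<open>q\<close>-shifted factorials and Lambert series\<close>

text \<open>With \<open>b = k / a\<close>, \<open>x = q^j\<close>, \<open>y = (k^2/a) q^j\<close>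
  the coefficient of the j-th \<alpha> is a multiple of the Watson series in \<open>x\<close> and
  \<open>y\<close>. For j = 0 this degenerates: at x = 1 all its terms with n > 0 vanish through
  \<open>(x;q)_n\<close>, while the \<beta>-series, which starts at n = 1, carries
  \<open>(q;q)_{n-1}\<close>, the limit of \<open>(x;q)_n / (1 - x)\<close>. Hence the derivative at
  x = 1, and hence the wish for terms entire in \<open>x\<close>, \<open>y\<close>, so that x -> 0
  and x -> 1 can be taken termwise. Inverting \<open>a\<close> and \<open>k\<close> replaces the
  Lambert arguments by their images under x |-> q/x or x |-> q^2/x. The two halves form logarithmic
  derivatives of theta functions except for some initial terms x/(1-x); these make up the rational
  function on the right. The duplication formula for x |-> x^2 links base q with base q^2. Only
  convergence of the three series is assumed, and nothing on the growth of \<alpha>; what can be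
  extracted is that the terms of the two \<alpha>-series tend to 0, and the interchange of sums has
  to work with that.\<close>

lemma qpoch_0 [simp]: "qpoch x q 0 = 1"
  by (simp add: qpoch_def)

lemma qpoch_Suc: "qpoch x q (Suc n) = qpoch x q n * (1 - x * q ^ n)"
  by (simp add: qpoch_def)

lemma qpoch_add: "qpoch x q (m + n) = qpoch x q m * qpoch (x * q ^ m) q n"
  by (induction n) (simp_all add: qpoch_Suc power_add mult.assoc)

lemma qpoch_Suc_left: "qpoch x q (Suc n) = (1 - x) * qpoch (x * q) q n"
  using qpoch_add[of x q 1 n] by (simp add: qpoch_Suc)

lemma qpoch_zero [simp]: "qpoch 0 q n = 1"
  by (simp add: qpoch_def)

lemma qpoch_double: "qpoch x q (2 * n) = qpoch x (q\<^sup>2) n * qpoch (x * q) (q\<^sup>2) n"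
proof (induction n)
  case (Suc n)
  have "qpoch x q (2 * Suc n) = qpoch x q (2 * n) * (1 - x * q ^ (2*n)) * (1 - x * q ^ (2*n+1))"
    by (simp add: qpoch_Suc)
  with Suc show ?case
    by (simp add: qpoch_Suc power_mult[symmetric] mult_ac power_add)
qed auto

lemma qpoch_eq_0_iff: "qpoch x q n = 0 \<longleftrightarrow> (\<exists>i<n. x * q ^ i = 1)"
  by (auto simp: qpoch_def)

lemma power2_norm_less_1:
  fixes q :: complex
  shows "norm q < 1 \<Longrightarrow> norm (q\<^sup>2) < 1"
  by (simp add: norm_power power_less_one_iff)

lemma summable_norm_qfactor:
  assumes "norm (q :: complex) < 1"
  shows "summable (\<lambda>i. norm (x * q ^ i))"
  using assms by (auto simp: norm_mult norm_power intro!: summable_mult summable_geometric)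

text \<open>\<open>1 + t \<le> exp t\<close> in each factor and the geometric sum give a bound
  independent of \<open>n\<close> and increasing in the norm of \<open>x\<close>; the
  dominated-convergence arguments below go back to it.\<close>

lemma norm_qpoch_le:
  assumes q: "norm q < 1"
  shows "norm (qpoch x q n) \<le> exp (norm x / (1 - norm q))"
proof -
  have "norm (qpoch x q n) = (\<Prod>i<n. norm (1 - x * q ^ i))"
    by (simp add: qpoch_def prod_norm)
  also have "\<dots> \<le> (\<Prod>i<n. exp (norm x * norm q ^ i))"
  proof (rule prod_mono)
    fix i
    have "norm (1 - x * q ^ i) \<le> 1 + norm x * norm q ^ i"
      using norm_triangle_ineq4[of 1 "x * q ^ i"] by (simp add: norm_mult norm_power)
    also have "\<dots> \<le> exp (norm x * norm q ^ i)"
      by (rule exp_ge_add_one_self)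
    finally show "0 \<le> norm (1 - x * q ^ i) \<and> norm (1 - x * q ^ i) \<le> exp (norm x * norm q ^ i)"
      by simp
  qed
  also have "\<dots> = exp (norm x * (\<Sum>i<n. norm q ^ i))"
    by (simp add: exp_sum sum_distrib_left)
  also have "\<dots> \<le> exp (norm x * (1 / (1 - norm q)))"
  proof -
    have "(\<Sum>i<n. norm q ^ i) \<le> (\<Sum>i. norm q ^ i)"
      by (rule sum_le_suminf) (use q in \<open>auto intro: summable_geometric\<close>)
    also have "\<dots> = 1 / (1 - norm q)"
      by (rule suminf_geometric) (use q in auto)
    finally show ?thesis
      unfolding exp_le_cancel_iff by (rule mult_left_mono) auto
  qed
  finally show ?thesis by simp
qed

lemma abs_convergent_prod_qpoch:
  fixes q :: complex
  assumes "norm q < 1"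
  shows "abs_convergent_prod (\<lambda>i. 1 - x * q ^ i)"
  using summable_norm_qfactor[OF assms, of x]
  by (auto simp: abs_convergent_prod_conv_summable)

lemma convergent_prod_qpoch:
  fixes q :: complex
  assumes "norm q < 1"
  shows "convergent_prod (\<lambda>i. 1 - x * q ^ i)"
  by (rule abs_convergent_prod_imp_convergent_prod[OF abs_convergent_prod_qpoch[OF assms]])

lemma qpoch_tendsto_qpoch_inf:
  assumes "norm q < 1"
  shows "qpoch x q \<longlonglongrightarrow> qpoch_inf x q"
proof -
  have "(\<lambda>n. \<Prod>i\<le>n. 1 - x * q ^ i) \<longlonglongrightarrow> qpoch_inf x q"
    unfolding qpoch_inf_def by (rule convergent_prod_LIMSEQ[OF convergent_prod_qpoch[OF assms]])
  hence "(\<lambda>n. qpoch x q (Suc n)) \<longlonglongrightarrow> qpoch_inf x q"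
    by (simp add: qpoch_def lessThan_Suc_atMost)
  thus ?thesis by (simp only: filterlim_sequentially_Suc)
qed

lemma qpoch_inf_zero [simp]: "qpoch_inf 0 q = 1"
  by (simp add: qpoch_inf_def)

lemma norm_qpoch_inf_le:
  assumes "norm q < 1"
  shows "norm (qpoch_inf x q) \<le> exp (norm x / (1 - norm q))"
  by (rule tendsto_upperbound[OF tendsto_norm[OF qpoch_tendsto_qpoch_inf[OF assms]]])
     (auto simp: norm_qpoch_le[OF assms])

lemma qpoch_inf_split:
  assumes "norm q < 1"
  shows "qpoch_inf x q = qpoch x q n * qpoch_inf (x * q ^ n) q"
proof -
  have "(\<lambda>m. qpoch x q (n + m)) \<longlonglongrightarrow> qpoch x q n * qpoch_inf (x * q ^ n) q"
    unfolding qpoch_add by (intro tendsto_intros qpoch_tendsto_qpoch_inf assms)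
  moreover have "(\<lambda>m. qpoch x q (m + n)) \<longlonglongrightarrow> qpoch_inf x q"
    by (rule LIMSEQ_ignore_initial_segment[OF qpoch_tendsto_qpoch_inf[OF assms]])
  ultimately show ?thesis
    by (metis (no_types, lifting) LIMSEQ_unique add.commute ext)
qed

lemma qpoch_inf_Suc:
  assumes "norm q < 1"
  shows "qpoch_inf x q = (1 - x) * qpoch_inf (x * q) q"
  using qpoch_inf_split[OF assms, of x 1] by (simp add: qpoch_Suc)

lemma qpoch_inf_eq_0_iff:
  assumes "norm q < 1"
  shows "qpoch_inf x q = 0 \<longleftrightarrow> (\<exists>i. x * q ^ i = 1)"
  unfolding qpoch_inf_def
  using prodinf_nonzero[OF convergent_prod_qpoch[OF assms], of x]
    has_prod_eq_0_iff[OF convergent_prod_has_prod[OF convergent_prod_qpoch[OF assms, of x]]]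
  by auto

lemma qpoch_nonzero_if_qpoch_inf:
  assumes "norm q < 1" "qpoch_inf x q \<noteq> 0"
  shows "qpoch x q n \<noteq> 0"
  using assms by (simp add: qpoch_inf_eq_0_iff qpoch_eq_0_iff)

lemma qpoch_inf_nonzeroI:
  assumes "norm q < 1" "\<And>n. qpoch x q n \<noteq> 0"
  shows "qpoch_inf x q \<noteq> 0"
  using assms(2) by (auto simp: qpoch_inf_eq_0_iff[OF assms(1)] qpoch_eq_0_iff)

lemma qpoch_inf_self_nonzero:
  assumes "norm q < 1"
  shows "qpoch_inf q q \<noteq> 0"
proof -
  have "norm (q * q ^ i) < 1" for i
    using assms by (simp add: power_Suc[symmetric] norm_power power_less_one_iff del: power_Suc)
  thus ?thesis
    by (metis assms norm_one order_less_irrefl qpoch_inf_eq_0_iff)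
qed

lemma qpoch_inf_nonzero_norm:
  assumes "norm q < 1" "norm x < 1"
  shows "qpoch_inf x q \<noteq> 0"
proof -
  have "norm (x * q ^ i) < 1" for i
  proof -
    have "norm (x * q ^ i) \<le> norm x * 1"
      unfolding norm_mult norm_power using assms by (intro mult_left_mono power_le_one) auto
    thus ?thesis using assms by simp
  qed
  thus ?thesis
    by (metis assms(1) norm_one order_less_irrefl qpoch_inf_eq_0_iff)
qed

lemma qpoch_inf_double:
  assumes "norm q < 1"
  shows "qpoch_inf x q = qpoch_inf x (q\<^sup>2) * qpoch_inf (x * q) (q\<^sup>2)"
proof -
  have "(\<lambda>n. qpoch x q (2 * n)) \<longlonglongrightarrow> qpoch_inf x q"
    by (rule filterlim_compose[OF qpoch_tendsto_qpoch_inf[OF assms]])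
       (auto intro: filterlim_at_top_mono[OF filterlim_ident])
  moreover have "(\<lambda>n. qpoch x q (2 * n)) \<longlonglongrightarrow> qpoch_inf x (q\<^sup>2) * qpoch_inf (x * q) (q\<^sup>2)"
    unfolding qpoch_double by (intro tendsto_intros qpoch_tendsto_qpoch_inf power2_norm_less_1 assms)
  ultimately show ?thesis by (rule LIMSEQ_unique)
qed

lemma qpoch_inf_square:
  assumes "norm q < 1"
  shows "qpoch_inf x q * qpoch_inf (- x) q = qpoch_inf (x\<^sup>2) (q\<^sup>2)"
proof -
  have "qpoch x q n * qpoch (- x) q n = qpoch (x\<^sup>2) (q\<^sup>2) n" for n
    by (simp add: qpoch_def prod.distrib[symmetric] algebra_simps power2_eq_square power_mult_distrib)
  moreover have "(\<lambda>n. qpoch x q n * qpoch (- x) q n) \<longlonglongrightarrow> qpoch_inf x q * qpoch_inf (- x) q"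
    by (intro tendsto_intros qpoch_tendsto_qpoch_inf assms)
  ultimately show ?thesis
    using qpoch_tendsto_qpoch_inf[OF power2_norm_less_1[OF assms], of "x\<^sup>2"] by (auto dest: LIMSEQ_unique)
qed

section \<open>Locally uniform convergence and analyticity in the first argument\<close>

lemma uniform_limit_qpoch:
  assumes "norm q < 1" "compact A"
  shows "uniform_limit A (\<lambda>n x. qpoch x q n) (\<lambda>x. qpoch_inf x q) sequentially"
proof -
  obtain R where R: "\<And>x. x \<in> A \<Longrightarrow> norm x \<le> R"
    using compact_imp_bounded[OF assms(2)] by (auto simp: bounded_iff)
  have "uniformly_convergent_on A (\<lambda>N x. \<Prod>n<N. 1 - x * q ^ n)"
  proof (rule uniformly_convergent_on_prod')
    show "uniformly_convergent_on A (\<lambda>N x. \<Sum>n<N. norm ((1 - x * q ^ n) - 1))"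
    proof (rule Weierstrass_m_test'_ev)
      show "\<forall>\<^sub>F n in sequentially. \<forall>x\<in>A. norm (norm (1 - x * q ^ n - 1)) \<le> R * norm q ^ n"
        using R by (auto simp: norm_mult norm_power intro!: always_eventually mult_right_mono)
      show "summable (\<lambda>n. R * norm q ^ n)"
        using assms by (auto intro!: summable_mult summable_geometric)
    qed
  qed (use assms in \<open>auto intro!: continuous_intros\<close>)
  then obtain l where l: "uniform_limit A (\<lambda>n x. qpoch x q n) l sequentially"
    by (auto simp: uniformly_convergent_on_def qpoch_def)
  have "l x = qpoch_inf x q" if "x \<in> A" for x
    using tendsto_uniform_limitI[OF l that] qpoch_tendsto_qpoch_inf[OF assms(1)] LIMSEQ_unique by blast
  thus ?thesis using l by (metis (mono_tags, lifting) uniform_limit_cong')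
qed

lemma holomorphic_qpoch [holomorphic_intros]: "(\<lambda>x. qpoch x q n) holomorphic_on A"
  by (auto simp: qpoch_def intro!: holomorphic_intros)

lemma holomorphic_qpoch_inf_UNIV:
  assumes "norm q < 1"
  shows "(\<lambda>x. qpoch_inf x q) holomorphic_on UNIV"
proof (rule holomorphic_uniform_sequence)
  show "\<exists>d>0. cball x d \<subseteq> UNIV \<and>
           uniform_limit (cball x d) (\<lambda>n x. qpoch x q n) (\<lambda>x. qpoch_inf x q) sequentially" for x
    by (rule exI[of _ 1]) (use assms in \<open>auto intro!: uniform_limit_qpoch\<close>)
qed (auto intro!: holomorphic_intros)

lemma holomorphic_qpoch_inf [holomorphic_intros]:
  assumes "norm q < 1" "f holomorphic_on A"
  shows "(\<lambda>x. qpoch_inf (f x) q) holomorphic_on A"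
  using holomorphic_on_compose_gen[OF assms(2) holomorphic_qpoch_inf_UNIV[OF assms(1)]]
  by (simp add: o_def)

lemma analytic_qpoch_inf [analytic_intros]:
  assumes "norm q < 1" "f analytic_on A"
  shows "(\<lambda>x. qpoch_inf (f x) q) analytic_on A"
proof -
  have "(\<lambda>x. qpoch_inf x q) analytic_on UNIV"
    using holomorphic_qpoch_inf_UNIV[OF assms(1)] by (simp add: analytic_on_open)
  from analytic_on_compose_gen[OF assms(2) this] show ?thesis by (simp add: o_def)
qed

lemma continuous_qpoch_inf [continuous_intros]:
  assumes "norm q < 1" "continuous_on A f"
  shows "continuous_on A (\<lambda>x. qpoch_inf (f x) q)"
  using continuous_on_compose2[OF holomorphic_on_imp_continuous_on[OF
      holomorphic_qpoch_inf_UNIV[OF assms(1)]] assms(2)] by auto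

lemma tendsto_qpoch_inf [tendsto_intros]:
  assumes "norm q < 1" "(f \<longlongrightarrow> l) net"
  shows "((\<lambda>x. qpoch_inf (f x) q) \<longlongrightarrow> qpoch_inf l q) net"
proof (rule tendsto_compose[OF _ assms(2)])
  have "isCont (\<lambda>x. qpoch_inf x q) l"
    using holomorphic_on_imp_continuous_on[OF holomorphic_qpoch_inf_UNIV[OF assms(1)]]
    by (simp add: continuous_on_eq_continuous_at)
  thus "((\<lambda>x. qpoch_inf x q) \<longlongrightarrow> qpoch_inf l q) (at l)"
    by (simp add: isCont_def)
qed

lemma tendsto_qpoch [tendsto_intros]:
  assumes "(f \<longlongrightarrow> l) net"
  shows "((\<lambda>x. qpoch (f x) q n) \<longlongrightarrow> qpoch l q n) net"
  unfolding qpoch_def by (intro tendsto_intros assms)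

section \<open>Lambert series as logarithmic derivatives\<close>

definition qlambert :: "complex \<Rightarrow> complex \<Rightarrow> complex" where
  "qlambert x q = (\<Sum>i. x * q ^ i / (1 - x * q ^ i))"

text \<open>Locally uniform convergence of the product permits logarithmic differentiation factor by
  factor; multiplication by \<open>- x\<close> then gives the Lambert series, with its convergence
  included.\<close>

lemma
  assumes q: "norm q < 1" and nz: "qpoch_inf x q \<noteq> 0"
  shows qlambert_sums: "(\<lambda>i. x * q ^ i / (1 - x * q ^ i)) sums qlambert x q"
    and qlambert_eq_logderiv: "qlambert x q = - x * deriv (\<lambda>x. qpoch_inf x q) x / qpoch_inf x q"
proof -
  have "(\<lambda>k. deriv (\<lambda>x. 1 - x * q ^ k) x / (1 - x * q ^ k)) sums
          (deriv (\<lambda>x. qpoch_inf x q) x / qpoch_inf x q)"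
  proof (rule logderiv_prodinf_complex_uniform_limit[where A = "ball x 1"])
    show "uniform_limit (ball x 1) (\<lambda>n x. \<Prod>k<n. 1 - x * q ^ k) (\<lambda>x. qpoch_inf x q) sequentially"
      using uniform_limit_on_subset[OF uniform_limit_qpoch[OF q compact_cball] ball_subset_cball]
      by (simp add: qpoch_def)
  qed (use nz in \<open>auto intro!: holomorphic_intros\<close>)
  moreover have "deriv (\<lambda>x. 1 - x * q ^ k) x = - (q ^ k)" for k
    by (rule DERIV_imp_deriv) (auto intro!: derivative_eq_intros)
  ultimately have "(\<lambda>k. - (q ^ k) / (1 - x * q ^ k)) sums
      (deriv (\<lambda>x. qpoch_inf x q) x / qpoch_inf x q)" by simp
  from sums_mult[OF this, of "- x"]
  have *: "(\<lambda>i. x * q ^ i / (1 - x * q ^ i)) sums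
             (- x * deriv (\<lambda>x. qpoch_inf x q) x / qpoch_inf x q)"
    by (simp add: field_simps)
  thus "(\<lambda>i. x * q ^ i / (1 - x * q ^ i)) sums qlambert x q"
    and "qlambert x q = - x * deriv (\<lambda>x. qpoch_inf x q) x / qpoch_inf x q"
    by (simp_all add: qlambert_def sums_iff)
qed

lemma qlambert_Suc:
  assumes "norm q < 1" "qpoch_inf x q \<noteq> 0"
  shows "qlambert x q = x / (1 - x) + qlambert (x * q) q"
proof -
  have "qpoch_inf (x * q) q \<noteq> 0"
    using assms qpoch_inf_Suc[of q x] by auto
  from qlambert_sums[OF assms(1) this] 
  have "(\<lambda>i. x * q ^ (Suc i) / (1 - x * q ^ (Suc i))) sums qlambert (x * q) q"
    by (simp add: mult_ac)
  from sums_Suc[OF this] have "(\<lambda>i. x * q ^ i / (1 - x * q ^ i)) sums (qlambert (x * q) q + x / (1 - x))"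
    by simp
  thus ?thesis
    using qlambert_sums[OF assms] sums_unique2 by fastforce
qed

lemma qlambert_double:
  assumes q: "norm q < 1" and nz: "qpoch_inf x q \<noteq> 0"
  shows "qlambert x q = qlambert x (q\<^sup>2) + qlambert (x * q) (q\<^sup>2)"
proof -
  note q2 = power2_norm_less_1[OF q]
  have nz': "qpoch_inf x (q\<^sup>2) \<noteq> 0" "qpoch_inf (x * q) (q\<^sup>2) \<noteq> 0"
    using nz qpoch_inf_double[OF q, of x] by auto
  let ?f = "\<lambda>i. x * q ^ i / (1 - x * q ^ i)"
  have "(\<lambda>n. \<Sum>i<2*n. ?f i) \<longlonglongrightarrow> qlambert x q"
    using qlambert_sums[OF q nz] unfolding sums_def
    by (rule filterlim_compose) (auto intro: filterlim_at_top_mono[OF filterlim_ident])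
  moreover have "(\<Sum>i<2*n. ?f i) = (\<Sum>i<n. x * (q\<^sup>2) ^ i / (1 - x * (q\<^sup>2) ^ i)) +
      (\<Sum>i<n. x * q * (q\<^sup>2) ^ i / (1 - x * q * (q\<^sup>2) ^ i))" for n
    by (induction n) (simp_all add: power_mult[symmetric] mult_ac)
  moreover have "(\<lambda>n. (\<Sum>i<n. x * (q\<^sup>2) ^ i / (1 - x * (q\<^sup>2) ^ i)) +
      (\<Sum>i<n. x * q * (q\<^sup>2) ^ i / (1 - x * q * (q\<^sup>2) ^ i))) \<longlonglongrightarrow> qlambert x (q\<^sup>2) + qlambert (x * q) (q\<^sup>2)"
    using qlambert_sums[OF q2 nz'(1)] qlambert_sums[OF q2 nz'(2)] unfolding sums_def
    by (intro tendsto_intros)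
  ultimately show ?thesis
    using LIMSEQ_unique by auto
qed

text \<open>Termwise, \<open>w / (1 - w) - w / (1 + w) = 2 w^2 / (1 - w^2)\<close> with
  \<open>w = x q^i\<close>.\<close>

lemma qlambert_square:
  assumes q: "norm q < 1" and nz: "qpoch_inf (x\<^sup>2) (q\<^sup>2) \<noteq> 0"
  shows "qlambert x q + qlambert (- x) q = 2 * qlambert (x\<^sup>2) (q\<^sup>2)"
proof -
  note q2 = power2_norm_less_1[OF q]
  have nz': "qpoch_inf x q \<noteq> 0" "qpoch_inf (- x) q \<noteq> 0"
    using nz qpoch_inf_square[OF q, of x] by auto
  have nz1: "1 - x * q ^ i \<noteq> 0" "1 + x * q ^ i \<noteq> 0" for i
  proof -
    show "1 - x * q ^ i \<noteq> 0"
      using nz'(1) unfolding qpoch_inf_eq_0_iff[OF q] by (metis right_minus_eq)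
    have "- x * q ^ i \<noteq> 1"
      using nz'(2) unfolding qpoch_inf_eq_0_iff[OF q] by blast
    thus "1 + x * q ^ i \<noteq> 0"
      by (metis add.inverse_inverse add_eq_0_iff mult_minus_left)
  qed
  have "(\<lambda>i. x * q ^ i / (1 - x * q ^ i) + (- x) * q ^ i / (1 - (- x) * q ^ i)) sums
          (qlambert x q + qlambert (- x) q)"
    by (intro sums_add qlambert_sums q nz')
  moreover have "x * q ^ i / (1 - x * q ^ i) + (- x) * q ^ i / (1 - (- x) * q ^ i) =
      2 * (x\<^sup>2 * (q\<^sup>2) ^ i / (1 - x\<^sup>2 * (q\<^sup>2) ^ i))" for i
  proof -
    define w where "w = x * q ^ i"
    have w: "1 - w \<noteq> 0" "1 + w \<noteq> 0"
      using nz1[of i] by (simp_all add: w_def)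
    have sq: "x\<^sup>2 * (q\<^sup>2) ^ i = w * w"
      by (simp add: w_def power2_eq_square power_mult_distrib)
    have "w / (1 - w) + (- w) / (1 + w) = (w * (1 + w) - w * (1 - w)) / ((1 - w) * (1 + w))"
      using diff_frac_eq[OF w, of w w] by (simp add: mult_ac)
    also have "\<dots> = 2 * (w * w / (1 - w * w))"
      by (simp add: algebra_simps)
    finally show ?thesis
      unfolding sq by (simp add: w_def)
  qed
  ultimately have "(\<lambda>i. 2 * (x\<^sup>2 * (q\<^sup>2) ^ i / (1 - x\<^sup>2 * (q\<^sup>2) ^ i))) sums
          (qlambert x q + qlambert (- x) q)" by simp
  thus ?thesis
    using sums_mult[OF qlambert_sums[OF q2 nz], of 2] by (simp add: sums_iff)
qed

subsection \<open>A \<open>q\<close>-analogue of Watson's summation\<close>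

text \<open>The coefficient recursion becomes a functional equation between \<open>\<Phi> w\<close>
  and \<open>\<Phi> (w * q)\<close>; iterating it drives the argument to 0, where continuity of the
  power series finishes the proof.\<close>

lemma q_binomial_thm:
  assumes q: "norm q < 1" and z: "norm z < 1"
  shows "(\<lambda>n. qpoch b q n / qpoch q q n * z ^ n) sums (qpoch_inf (b * z) q / qpoch_inf z q)"
proof -
  define c where "c = (\<lambda>n. qpoch b q n / qpoch q q n)"
  define \<Phi> where "\<Phi> = (\<lambda>z. \<Sum>n. c n * z ^ n)"
  have qn0: "qpoch q q n \<noteq> 0" for n
    by (rule qpoch_nonzero_if_qpoch_inf[OF q qpoch_inf_self_nonzero[OF q]])
  \<comment> \<open>The denominator on the right is fixed, so \<open>1/(q;q)_n\<close> is bounded in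
    \<open>n\<close>; this is where \<open>K\<close> comes from.\<close>
  have inv: "inverse (qpoch q q n) = qpoch_inf (q * q ^ n) q / qpoch_inf q q" for n
    using qpoch_inf_split[OF q, of q n] qn0[of n] qpoch_inf_self_nonzero[OF q] by (simp add: field_simps)
  define K where "K = exp (norm b / (1 - norm q)) * (exp (1 / (1 - norm q)) / norm (qpoch_inf q q))"
  have c_le: "norm (c n) \<le> K" for n
  proof -
    have "norm (q * q ^ n) \<le> 1"
      using q by (simp add: norm_power power_Suc[symmetric] power_le_one del: power_Suc)
    hence "norm (qpoch_inf (q * q ^ n) q) \<le> exp (1 / (1 - norm q))"
      using norm_qpoch_inf_le[OF q, of "q * q ^ n"] q
      by (elim order_trans) (simp add: divide_right_mono)
    moreover have "c n = qpoch b q n * (qpoch_inf (q * q ^ n) q / qpoch_inf q q)"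
      by (simp add: c_def divide_inverse inv[unfolded divide_inverse])
    ultimately show ?thesis
      by (auto simp: K_def norm_mult norm_divide intro!: mult_mono divide_right_mono norm_qpoch_le q)
  qed
  have c_sum: "summable (\<lambda>n. c n * w ^ n)" if "norm w < 1" for w
  proof (rule summable_comparison_test)
    show "\<exists>N. \<forall>n\<ge>N. norm (c n * w ^ n) \<le> K * norm w ^ n"
      using c_le by (auto simp: norm_mult norm_power intro!: mult_right_mono)
    show "summable (\<lambda>n. K * norm w ^ n)"
      using that by (auto intro!: summable_mult summable_geometric)
  qed
  have c_rec: "(1 - q ^ Suc n) * c (Suc n) = (1 - b * q ^ n) * c n" for n
    using qn0[of n] qn0[of "Suc n"] by (simp add: c_def qpoch_Suc field_simps)
  \<comment> \<open>Both sides of the recursion \<open>c_rec\<close> are summed against powers of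
    \<open>w\<close>. The constant terms of \<open>\<Phi> w\<close> and
    \<open>\<Phi> (w * q)\<close> cancel, so shifting the index by one loses nothing.\<close>
  have step: "(1 - w) * \<Phi> w = (1 - b * w) * \<Phi> (w * q)" if w: "norm w < 1" for w
  proof -
    have wq: "norm (w * q) < 1"
      using w q by (simp add: norm_mult mult_strict_mono[of "norm w" 1 "norm q" 1, simplified])
    note S = summable_sums[OF c_sum[OF w]] summable_sums[OF c_sum[OF wq]]
    have "(\<lambda>n. c n * w ^ n - c n * (w * q) ^ n) sums (\<Phi> w - \<Phi> (w * q))"
      unfolding \<Phi>_def by (intro sums_diff S)
    moreover have "(\<lambda>n. w * (c n * w ^ n - b * (c n * (w * q) ^ n))) sums (w * (\<Phi> w - b * \<Phi> (w * q)))"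
      unfolding \<Phi>_def by (intro sums_mult sums_diff S)
    hence "(\<lambda>n. c (Suc n) * w ^ Suc n - c (Suc n) * (w * q) ^ Suc n) sums (w * (\<Phi> w - b * \<Phi> (w * q)))"
    proof (rule sums_cong[THEN iffD1, rotated])
      fix n
      have "c (Suc n) * w ^ Suc n - c (Suc n) * (w * q) ^ Suc n = w ^ Suc n * ((1 - q ^ Suc n) * c (Suc n))"
        by (simp add: power_mult_distrib algebra_simps)
      thus "w * (c n * w ^ n - b * (c n * (w * q) ^ n)) = c (Suc n) * w ^ Suc n - c (Suc n) * (w * q) ^ Suc n"
        unfolding c_rec by (simp add: power_mult_distrib algebra_simps)
    qed
    from sums_Suc[OF this] have "(\<lambda>n. c n * w ^ n - c n * (w * q) ^ n) sums (w * (\<Phi> w - b * \<Phi> (w * q)))"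
      by simp
    ultimately have "\<Phi> w - \<Phi> (w * q) = w * (\<Phi> w - b * \<Phi> (w * q))"
      by (rule sums_unique2)
    thus ?thesis by (simp add: algebra_simps)
  qed
  have norm_zq: "norm (z * q ^ n) < 1" for n
  proof -
    have "norm (z * q ^ n) \<le> norm z * 1"
      unfolding norm_mult norm_power using q by (intro mult_left_mono power_le_one) auto
    thus ?thesis using z by simp
  qed
  have "qpoch z q n * \<Phi> z = qpoch (b * z) q n * \<Phi> (z * q ^ n)" for n
  proof (induction n)
    case (Suc n)
    have "qpoch z q (Suc n) * \<Phi> z = qpoch (b * z) q n * ((1 - z * q ^ n) * \<Phi> (z * q ^ n))"
      using Suc by (simp add: qpoch_Suc)
    also have "\<dots> = qpoch (b * z) q (Suc n) * \<Phi> (z * q ^ Suc n)"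
      unfolding step[OF norm_zq] by (simp add: qpoch_Suc mult_ac)
    finally show ?case .
  qed simp
  moreover have "(\<lambda>n. qpoch (b * z) q n * \<Phi> (z * q ^ n)) \<longlonglongrightarrow> qpoch_inf (b * z) q * \<Phi> 0"
  proof (intro tendsto_mult qpoch_tendsto_qpoch_inf q)
    have "isCont \<Phi> 0"
      unfolding \<Phi>_def by (rule isCont_powser[of _ "1/2"]) (auto intro: c_sum)
    moreover have "(\<lambda>n. z * q ^ n) \<longlonglongrightarrow> 0"
      using q by (auto intro!: tendsto_mult_right_zero LIMSEQ_power_zero)
    ultimately show "(\<lambda>n. \<Phi> (z * q ^ n)) \<longlonglongrightarrow> \<Phi> 0"
      by (rule isCont_tendsto_compose)
  qed
  moreover have "(\<lambda>n. qpoch z q n * \<Phi> z) \<longlonglongrightarrow> qpoch_inf z q * \<Phi> z"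
    by (intro tendsto_intros qpoch_tendsto_qpoch_inf q)
  moreover have "\<Phi> 0 = 1"
    using powser_zero[of c] by (simp add: \<Phi>_def c_def)
  ultimately have "qpoch_inf z q * \<Phi> z = qpoch_inf (b * z) q"
    using LIMSEQ_unique by fastforce
  moreover have "qpoch_inf z q \<noteq> 0"
    by (rule qpoch_inf_nonzero_norm[OF q z])
  ultimately have "\<Phi> z = qpoch_inf (b * z) q / qpoch_inf z q"
    by (simp add: field_simps)
  with summable_sums[OF c_sum[OF z]] show ?thesis
    by (simp add: \<Phi>_def c_def)
qed

text \<open>
  Multiplying the terms of the very-well-poised series by infinite products clears all denominators
  and makes them entire in \<open>x\<close> and \<open>y\<close>; the factor \<open>qpoch x q n\<close> is split off since its zero at
  \<open>x = 1\<close> is divided out later.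
\<close>

definition watson_core :: "complex \<Rightarrow> complex \<Rightarrow> complex \<Rightarrow> complex \<Rightarrow> nat \<Rightarrow> complex" where
  "watson_core q b x y n =
     (1 - x * y / b * q ^ (2 * n)) * qpoch (x * y / b) q n * qpoch b q n * qpoch y q n *
     qpoch (x * y * q / b\<^sup>2) (q\<^sup>2) n *
     qpoch_inf (q * q ^ n) q * qpoch_inf (x * y * q / b\<^sup>2 * q ^ n) q *
     qpoch_inf (x * q / b * q ^ n) q * qpoch_inf (y * q / b * q ^ n) q *
     qpoch_inf (x * y * q * q ^ (2 * n)) (q\<^sup>2) * (- q / b) ^ n"

definition watson_term :: "complex \<Rightarrow> complex \<Rightarrow> complex \<Rightarrow> complex \<Rightarrow> nat \<Rightarrow> complex" where
  "watson_term q b x y n = qpoch x q n * watson_core q b x y n"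

text \<open>Splitting off \<open>qpoch x q n\<close> hides the symmetry, which the full term still
  has. It lets the reduction to \<open>x = 0\<close> be applied to \<open>y\<close> as well.\<close>

lemma watson_term_commute: "watson_term q b x y n = watson_term q b y x n"
  by (simp add: watson_term_def watson_core_def mult_ac)

lemma norm_mult_power_le:
  fixes q :: complex
  assumes "norm q < 1" "norm c \<le> C"
  shows "norm (c * q ^ n) \<le> C"
proof -
  have "norm (c * q ^ n) \<le> norm c * 1"
    unfolding norm_mult norm_power using assms by (intro mult_left_mono power_le_one) auto
  thus ?thesis using assms by simp
qed

lemma norm_qpoch_le':
  assumes "norm q < 1" "norm c \<le> C"
  shows "norm (qpoch c q n) \<le> exp (C / (1 - norm q))"
  by (rule order_trans[OF norm_qpoch_le[OF assms(1)]]) (use assms in \<open>auto intro!: divide_right_mono\<close>)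

lemma norm_qpoch_inf_le':
  assumes "norm q < 1" "norm c \<le> C"
  shows "norm (qpoch_inf c q) \<le> exp (C / (1 - norm q))"
  by (rule order_trans[OF norm_qpoch_inf_le[OF assms(1)]]) (use assms in \<open>auto intro!: divide_right_mono\<close>)

text \<open>The power of \<open>- q / b\<close> is the only factor that is not merely bounded; the
  others stay bounded uniformly in \<open>n\<close> while \<open>x\<close> and \<open>y\<close>
  range over a disc. So \<open>norm q < norm b\<close> is what yields a summable majorant.\<close>

lemma watson_core_bound:
  assumes q: "norm q < 1"
  obtains K where "\<And>x y n. norm x \<le> R \<Longrightarrow> norm y \<le> R \<Longrightarrow>
    norm (watson_core q b x y n) \<le> K * norm (q / b) ^ n"
proof -
  note q2 = power2_norm_less_1[OF q]
  \<comment> \<open>The sum of bounds for all arguments that occur, so that one constant per base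
    serves every factor.\<close>
  define C where "C = R * R / norm b + R * R * norm q / (norm b)\<^sup>2 + norm q + norm b + R +
     R * norm q / norm b + R * R * norm q"
  define E where "E = exp (C / (1 - norm q))"
  define E2 where "E2 = exp (C / (1 - norm (q\<^sup>2)))"
  have "norm (watson_core q b x y n) \<le> ((1 + C) * E * E * E * E2 * E * E * E * E * E2) * norm (q / b) ^ n"
    if x: "norm x \<le> R" and y: "norm y \<le> R" for x y n
  proof -
    have R: "R \<ge> 0" using x norm_ge_zero order_trans by blast
    have xy: "norm x * norm y \<le> R * R" using x y R by (intro mult_mono) auto
    have nonneg: "0 \<le> R * R / norm b" "0 \<le> R * R * norm q / (norm b)\<^sup>2" "0 \<le> norm q" "0 \<le> norm b"
       "0 \<le> R * norm q / norm b" "0 \<le> R * R * norm q"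
      using R by auto
    have 1: "norm (x * y / b) \<le> C"
    proof -
      have "norm (x * y / b) \<le> R * R / norm b"
        using xy by (simp add: norm_mult norm_divide divide_right_mono)
      thus ?thesis using nonneg R unfolding C_def by linarith
    qed
    have 2: "norm (x * y * q / b\<^sup>2) \<le> C"
    proof -
      have "norm (x * y * q / b\<^sup>2) \<le> R * R * norm q / (norm b)\<^sup>2"
        using xy by (simp add: norm_mult norm_divide norm_power divide_right_mono mult_right_mono)
      thus ?thesis using nonneg R unfolding C_def by linarith
    qed
    have 3: "norm (x * q / b) \<le> C" "norm (y * q / b) \<le> C"
    proof -
      have "norm (x * q / b) \<le> R * norm q / norm b" "norm (y * q / b) \<le> R * norm q / norm b"
        using x y by (simp_all add: norm_mult norm_divide norm_power divide_right_mono mult_right_mono)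
      thus "norm (x * q / b) \<le> C" "norm (y * q / b) \<le> C" using nonneg R unfolding C_def by linarith+
    qed
    have 4: "norm (x * y * q) \<le> C"
    proof -
      have "norm (x * y * q) \<le> R * R * norm q"
        using xy by (simp add: norm_mult mult_right_mono)
      thus ?thesis using nonneg R unfolding C_def by linarith
    qed
    have 5: "norm q \<le> C" "norm b \<le> C" "norm y \<le> C"
      using nonneg R y unfolding C_def by linarith+
    have C0: "0 \<le> C" using 5(1) norm_ge_zero order_trans by blast
    have f0: "norm (1 - x * y / b * q ^ (2 * n)) \<le> 1 + C"
      using norm_triangle_ineq4[of 1 "x * y / b * q ^ (2 * n)"]
        norm_mult_power_le[OF q 1, of "2 * n"] by simp
    have p2: "q ^ (2 * n) = (q\<^sup>2) ^ n" by (simp add: power_mult)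
    have last: "norm ((- q / b) ^ n) = norm (q / b) ^ n"
      by (simp add: norm_power norm_divide)
    have b1: "norm (qpoch (x * y / b) q n) \<le> E" "norm (qpoch b q n) \<le> E" "norm (qpoch y q n) \<le> E"
      unfolding E_def by (intro norm_qpoch_le' q 1 5)+
    have b2: "norm (qpoch (x * y * q / b\<^sup>2) (q\<^sup>2) n) \<le> E2"
      unfolding E2_def by (intro norm_qpoch_le' q2 2)
    have b3: "norm (qpoch_inf (q * q ^ n) q) \<le> E" "norm (qpoch_inf (x * y * q / b\<^sup>2 * q ^ n) q) \<le> E"
      "norm (qpoch_inf (x * q / b * q ^ n) q) \<le> E" "norm (qpoch_inf (y * q / b * q ^ n) q) \<le> E"
      unfolding E_def by (intro norm_qpoch_inf_le' norm_mult_power_le q 2 3 5)+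
    have b4: "norm (qpoch_inf (x * y * q * q ^ (2 * n)) (q\<^sup>2)) \<le> E2"
      unfolding E2_def by (intro norm_qpoch_inf_le' norm_mult_power_le q q2 4)
    have "0 \<le> E" "0 \<le> E2" by (simp_all add: E_def E2_def)
    thus ?thesis
      unfolding watson_core_def norm_mult last
      by (intro mult_mono f0 b1 b2 b3 b4 mult_nonneg_nonneg order_refl)
         (use C0 in \<open>simp_all\<close>)
  qed
  thus ?thesis by (rule that)
qed

text \<open>The split-off factor has its own argument \<open>u\<close>, and the index a shift
  \<open>d\<close>, to cover two uses: \<open>u = x\<close>, \<open>d = 0\<close> for the series
  itself, and \<open>u = x q\<close>, \<open>d = 1\<close> for what remains of it after removal of
  the first term and division by \<open>1 - x\<close>.\<close>

lemma tendsto_suminf_watson: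
  assumes q: "norm q < 1" and qb: "norm q < norm b" and net: "net \<noteq> bot"
    and lim: "(f \<longlongrightarrow> x) net" "(g \<longlongrightarrow> y) net" "(h \<longlongrightarrow> u) net"
  shows "((\<lambda>i. \<Sum>n. qpoch (h i) q n * watson_core q b (f i) (g i) (n + d)) \<longlongrightarrow>
          (\<Sum>n. qpoch u q n * watson_core q b x y (n + d))) net"
    and "summable (\<lambda>n. qpoch u q n * watson_core q b x y (n + d))"
proof -
  note q2 = power2_norm_less_1[OF q]
  have b: "b \<noteq> 0" using qb by auto
  define R where "R = norm x + norm y + norm u + 1"
  obtain K where K: "\<And>x y n. norm x \<le> R \<Longrightarrow> norm y \<le> R \<Longrightarrow>
      norm (watson_core q b x y n) \<le> K * norm (q / b) ^ n"
    using watson_core_bound[OF q] by blast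
  define K' where "K' = exp (R / (1 - norm q)) * K"
  have le: "norm (qpoch w q n * watson_core q b x' y' (n + d)) \<le> K' * norm (q / b) ^ (n + d)"
    if "norm w \<le> R" "norm x' \<le> R" "norm y' \<le> R" for w x' y' n
    unfolding norm_mult K'_def mult.assoc
    by (intro mult_mono norm_qpoch_le' K q that) auto
  have qb': "norm (q / b) < 1"
    using qb by (simp add: norm_divide divide_less_eq)
  have ev: "eventually (\<lambda>i. norm (\<phi> i) \<le> R) net"
    if "(\<phi> \<longlongrightarrow> l) net" "norm l < R" for \<phi> l
    using order_tendstoD(2)[OF tendsto_norm[OF that(1)] that(2)] by eventually_elim auto
  have evs: "eventually (\<lambda>i. norm (h i) \<le> R \<and> norm (f i) \<le> R \<and> norm (g i) \<le> R) net"
    using ev[OF lim(1)] ev[OF lim(2)] ev[OF lim(3)]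
    by (auto simp: R_def add_pos_nonneg add_nonneg_pos eventually_conj_iff)
  let ?a = "\<lambda>n i. qpoch (h i) q n * watson_core q b (f i) (g i) (n + d)"
  have "eventually (\<lambda>n. summable (\<lambda>k. norm (?a k n))) net \<and>
           summable (\<lambda>n. norm (qpoch u q n * watson_core q b x y (n + d))) \<and>
           ((\<lambda>n. suminf (\<lambda>k. ?a k n)) \<longlongrightarrow> suminf (\<lambda>n. qpoch u q n * watson_core q b x y (n + d))) net"
  proof (rule tannerys_theorem)
    show "((\<lambda>i. ?a n i) \<longlongrightarrow> qpoch u q n * watson_core q b x y (n + d)) net" for n
      unfolding watson_core_def by (intro tendsto_intros q q2 lim) (use b in auto)
    show "eventually (\<lambda>(n, i). norm (?a n i) \<le> K' * norm (q / b) ^ (n + d)) (at_top \<times>\<^sub>F net)"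
      by (rule eventually_mono[OF eventually_prodI[OF always_eventually[of "\<lambda>_. True"] evs]])
         (auto intro!: le)
    show "summable (\<lambda>n. K' * norm (q / b) ^ (n + d))"
      using qb' by (simp add: power_add mult.assoc summable_mult2 summable_mult summable_geometric)
  qed (fact net)
  thus "((\<lambda>i. \<Sum>n. qpoch (h i) q n * watson_core q b (f i) (g i) (n + d)) \<longlongrightarrow>
          (\<Sum>n. qpoch u q n * watson_core q b x y (n + d))) net"
    and "summable (\<lambda>n. qpoch u q n * watson_core q b x y (n + d))"
    by (auto dest: summable_norm_cancel)
qed

lemma summable_watson_term:
  assumes "norm q < 1" "norm q < norm b"
  shows "summable (watson_term q b x y)"
  using tendsto_suminf_watson(2)[OF assms, of sequentially "\<lambda>_. x" x "\<lambda>_. y" y "\<lambda>_. x" x 0]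
  by (simp add: watson_term_def[abs_def])

lemma tendsto_suminf_watson_term:
  assumes "norm q < 1" "norm q < norm b" "net \<noteq> bot" "(f \<longlongrightarrow> x) net"
  shows "((\<lambda>i. \<Sum>n. watson_term q b (f i) y n) \<longlongrightarrow> (\<Sum>n. watson_term q b x y n)) net"
  using tendsto_suminf_watson(1)[OF assms(1-4) tendsto_const assms(4), of y 0]
  by (simp add: watson_term_def)

text \<open>
  Telescoping certificate for the shift \<open>x \<mapsto> x q\<^sup>2\<close>: with \<open>Q = q\<^sup>n\<close> and \<open>B = 1 / b\<close>, the left-hand side
  combines the \<open>n\<close>-th terms at \<open>x\<close> and \<open>x q\<^sup>2\<close>, and the right-hand side is a difference in \<open>n\<close>, up to a
  common factor. Iterating the shift reduces the summation to \<open>x = 0\<close>, by symmetry to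
  \<open>x = y = 0\<close>, and there it is the \<open>q\<close>-binomial theorem.
\<close>

lemma watson_certificate:
  fixes x y B q Q :: complex
  shows "(1 - x) * ((1 - x*y*B*Q^2) * (1 - x*y*q*B^2*Q) * (1 - x*y*q^2*B^2*Q) * (1 - x*q*B*Q) * (1 - x*q^2*B*Q) * (1 - x*y*q*Q^2))
    - (1 - x*q^2*B^2) * ((1 - x*y*B*q^2*Q^2) * (1 - x*y*B*Q) * (1 - x*y*B*q*Q) * (1 - x*Q) * (1 - x*q*Q) * (1 - x*y*q*B^2*Q^2))
    = x * (1 - q * B) * ( (- q * (B - Q)) * ((1 - x*y*B*Q) * (1 - x*Q) * (1 - y*Q) * (1 - x*y*q*B^2*Q^2)) * (1 - x^2*y*q*B^2*q^2*Q^2)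
       - ((1 - Q) * (1 - x*y*q^2*B^2*Q) * (1 - y*B*Q) * (1 - x*q^2*B*Q) * (1 - x*y*q*Q^2)) * (1 - x^2*y*q*B^2*Q^2))"
  by algebra

text \<open>The case \<open>Q = 1\<close> of \<open>watson_certificate\<close> with the factor
  \<open>1 - x\<close> divided out; the second product on the right disappears through
  \<open>1 - Q\<close>. It starts the telescoping at n = 0, where \<open>qpoch x q 0\<close> does
  not supply the factor \<open>1 - x\<close>.\<close>

lemma watson_certificate_0:
  fixes x y B q :: complex
  shows "(1 - x*y*B) * (1 - x*y*q*B^2) * (1 - x*y*q^2*B^2) * (1 - x*q*B) * (1 - x*q^2*B) * (1 - x*y*q)
    - (1 - x*q^2*B^2) * ((1 - x*y*B*q^2) * (1 - x*y*B) * (1 - x*y*B*q) * (1 - x*q) * (1 - x*y*q*B^2))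
    = x * (1 - q * B) * ((- q * (B - 1)) * ((1 - x*y*B) * (1 - y) * (1 - x*y*q*B^2)) * (1 - x^2*y*q*B^2*q^2))"
  by algebra


text \<open>Creative telescoping: the multiplier is the quotient of the expected closed forms at
  \<open>x\<close> and \<open>x q^2\<close>, and the partial sums of the difference are the explicit
  sequence \<open>g\<close>, a null sequence because it carries \<open>(- q / b)^n\<close>.\<close>

lemma suminf_watson_term_rec:
  assumes q: "norm q < 1" and qb: "norm q < norm b"
  shows "(\<Sum>n. watson_term q b x y n) =
    (1 - x * q\<^sup>2 / b\<^sup>2) * (1 - x * y / b) * (1 - x * y / b * q) * (1 - x * q) * (1 - x * y * q / b\<^sup>2) *
    (\<Sum>n. watson_term q b (x * q\<^sup>2) y n)"
proof -
  note q2 = power2_norm_less_1[OF q]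
  have b: "b \<noteq> 0" using qb by auto
  define B where "B = 1 / b"
  have bB: "b * B = 1" using b by (simp add: B_def)
  define L where "L = x * y * B"
  define X where "X = x * y * q * B\<^sup>2"
  have L: "x * y / b = L" "x * q\<^sup>2 * y / b = L * q\<^sup>2"
    by (simp_all add: L_def B_def)
  have X: "x * y * q / b\<^sup>2 = X" "x * q\<^sup>2 * y * q / b\<^sup>2 = X * q\<^sup>2"
    by (simp_all add: X_def B_def power_divide)
  \<comment> \<open>The part common to the cores at \<open>x\<close> and at \<open>x q^2\<close>,
    the latter first multiplied by \<open>(1 - L)(1 - L q)(1 - X)\<close>. What is left in
    \<open>A\<close> and \<open>C\<close> are the polynomials of the certificate.\<close>
  define u where "u = (\<lambda>n. qpoch L q n * qpoch b q n * qpoch y q n * qpoch X (q\<^sup>2) n *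
     qpoch_inf (q * q ^ n) q * qpoch_inf (X * q\<^sup>2 * q ^ n) q *
     qpoch_inf (x * q ^ 3 * B * q ^ n) q * qpoch_inf (y * q * B * q ^ n) q *
     qpoch_inf (x * y * q ^ 3 * q ^ (2 * n)) (q\<^sup>2) * (- q * B) ^ n)"
  have inf2: "qpoch_inf c q = (1 - c) * (1 - c * q) * qpoch_inf (c * q\<^sup>2) q" for c
    using qpoch_inf_split[OF q, of c 2] by (simp add: numeral_2_eq_2 qpoch_Suc)
  have inf1: "qpoch_inf c q = (1 - c) * qpoch_inf (c * q) q" for c
    by (rule qpoch_inf_Suc[OF q])
  have inf1': "qpoch_inf c (q\<^sup>2) = (1 - c) * qpoch_inf (c * q\<^sup>2) (q\<^sup>2)" for c
    by (rule qpoch_inf_Suc[OF q2])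
  have A: "watson_core q b x y n = u n * ((1 - L * (q^n)\<^sup>2) * (1 - X * q^n) * (1 - X * q * q^n) *
      (1 - x * q * B * q^n) * (1 - x * q\<^sup>2 * B * q^n) * (1 - x * y * q * (q^n)\<^sup>2))" for n
    unfolding watson_core_def L X u_def inf2[of "X * q ^ n"] inf2[of "x * q / b * q ^ n"]
      inf1'[of "x * y * q * q ^ (2 * n)"]
    by (simp add: B_def power_mult power2_eq_square power3_eq_cube mult_ac power_mult_distrib)
  have C: "(1 - L) * (1 - L * q) * (1 - X) * watson_core q b (x * q\<^sup>2) y n =
      u n * ((1 - L * q\<^sup>2 * (q^n)\<^sup>2) * (1 - L * q^n) * (1 - L * q * q^n) * (1 - X * (q^n)\<^sup>2))" for n
  proof -
    have 1: "(1 - L) * (1 - L * q) * qpoch (L * q\<^sup>2) q n = qpoch L q n * (1 - L * q ^ n) * (1 - L * q * q ^ n)"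
      using qpoch_add[of L q 2 n] qpoch_add[of L q n 2]
      by (simp add: numeral_2_eq_2 qpoch_Suc mult_ac)
    have 2: "(1 - X) * qpoch (X * q\<^sup>2) (q\<^sup>2) n = qpoch X (q\<^sup>2) n * (1 - X * (q ^ n)\<^sup>2)"
      using qpoch_Suc_left[of X "q\<^sup>2" n] qpoch_Suc[of X "q\<^sup>2" n]
      by (simp add: power_mult[symmetric] mult.commute)
    have "(1 - L) * (1 - L * q) * (1 - X) * watson_core q b (x * q\<^sup>2) y n =
       (1 - L * q\<^sup>2 * q ^ (2 * n)) * ((1 - L) * (1 - L * q) * qpoch (L * q\<^sup>2) q n) *
       qpoch b q n * qpoch y q n * ((1 - X) * qpoch (X * q\<^sup>2) (q\<^sup>2) n) *
     qpoch_inf (q * q ^ n) q * qpoch_inf (X * q\<^sup>2 * q ^ n) q *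
     qpoch_inf (x * q ^ 3 * B * q ^ n) q * qpoch_inf (y * q * B * q ^ n) q *
     qpoch_inf (x * y * q ^ 3 * q ^ (2 * n)) (q\<^sup>2) * (- q * B) ^ n"
      unfolding watson_core_def L X by (simp add: B_def power3_eq_cube power2_eq_square mult_ac)
    thus ?thesis
      unfolding 1 2 u_def by (simp add: power_mult power2_eq_square mult_ac power_mult_distrib)
  qed
  \<comment> \<open>The quotient \<open>u (n+1) / u n\<close> in cross-multiplied form, so that no
    factor has to be nonzero.\<close>
  have D: "u (Suc n) * ((1 - q * q^n) * (1 - X * q * (q * q^n)) * (1 - y * B * (q * q^n)) *
        (1 - x * q\<^sup>2 * B * (q * q^n)) * (1 - x * y * q * (q * q^n)\<^sup>2)) =
      u n * ((- q * (B - q^n)) * (1 - L * q^n) * (1 - y * q^n) * (1 - X * (q^n)\<^sup>2))" for n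
  proof -
    have z: "(1 - b * q ^ n) * (- q * B) = - q * (B - q ^ n)"
      using bB by (simp add: algebra_simps)
    have s: "q ^ (2 * Suc n) = q\<^sup>2 * q ^ (2 * n)" "q ^ Suc n = q * q ^ n"
      by (simp_all add: power2_eq_square)
    have "u n * ((- q * (B - q^n)) * (1 - L * q^n) * (1 - y * q^n) * (1 - X * (q^n)\<^sup>2)) = 
      (qpoch L q n * (1 - L * q ^ n)) * (qpoch b q n * (1 - b * q ^ n)) * (qpoch y q n * (1 - y * q ^ n)) * 
      (qpoch X (q\<^sup>2) n * (1 - X * (q\<^sup>2) ^ n)) *
     qpoch_inf (q * q ^ n) q * qpoch_inf (X * q\<^sup>2 * q ^ n) q *
     qpoch_inf (x * q ^ 3 * B * q ^ n) q * qpoch_inf (y * q * B * q ^ n) q *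
     qpoch_inf (x * y * q ^ 3 * q ^ (2 * n)) (q\<^sup>2) * ((- q * B) ^ n * (- q * B))"
      unfolding u_def z[symmetric] by (simp add: power_mult[symmetric] mult_ac)
    also have "\<dots> = u (Suc n) * ((1 - q * q^n) * (1 - X * q * (q * q^n)) * (1 - y * B * (q * q^n)) *
        (1 - x * q\<^sup>2 * B * (q * q^n)) * (1 - x * y * q * (q * q^n)\<^sup>2))"
      unfolding u_def qpoch_Suc s inf1[of "q * q ^ n"] inf1[of "X * q\<^sup>2 * q ^ n"]
        inf1[of "x * q ^ 3 * B * q ^ n"] inf1[of "y * q * B * q ^ n"] inf1'[of "x * y * q ^ 3 * q ^ (2 * n)"]
      by (simp add: power2_eq_square power3_eq_cube mult_ac power_mult power_mult_distrib)
    finally show ?thesis by simp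
  qed
  define R where "R = (1 - x * q\<^sup>2 * B\<^sup>2) * (1 - L) * (1 - L * q) * (1 - x * q) * (1 - X)"
  define g where "g = (\<lambda>n. x * (1 - q * B) * qpoch (x * q) q n *
     (u n * ((- q * (B - q^n)) * (1 - L * q^n) * (1 - y * q^n) * (1 - X * (q^n)\<^sup>2))) * (1 - x * q\<^sup>2 * X * (q^n)\<^sup>2))"
  have R_term: "R * watson_term q b (x * q\<^sup>2) y n = (1 - x * q\<^sup>2 * B\<^sup>2) * qpoch (x * q) q n * (1 - x * q * q ^ n) *
      (u n * ((1 - L * q\<^sup>2 * (q^n)\<^sup>2) * (1 - L * q^n) * (1 - L * q * q^n) * (1 - X * (q^n)\<^sup>2)))" for n
  proof -
    have "(1 - x * q) * qpoch (x * q\<^sup>2) q n = qpoch (x * q) q n * (1 - x * q * q ^ n)"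
      using qpoch_Suc_left[of "x * q" q n] qpoch_Suc[of "x * q" q n] by (simp add: power2_eq_square mult.assoc)
    thus ?thesis
      unfolding R_def watson_term_def C[symmetric] by (simp add: mult_ac) 
  qed
  have tel: "(\<Sum>m\<le>n. watson_term q b x y m - R * watson_term q b (x * q\<^sup>2) y m) = g n" for n
  proof (induction n)
    case 0
    show ?case
    proof -
      have "watson_term q b x y 0 =
          u 0 * ((1 - L) * (1 - X) * (1 - X * q) * (1 - x * q * B) * (1 - x * q\<^sup>2 * B) * (1 - x * y * q))"
        unfolding watson_term_def A by (simp only: qpoch_0 power_0 power_one mult_1_right mult_1_left)
      moreover have "R * watson_term q b (x * q\<^sup>2) y 0 =
          u 0 * ((1 - x * q\<^sup>2 * B\<^sup>2) * ((1 - L * q\<^sup>2) * (1 - L) * (1 - L * q) * (1 - x * q) * (1 - X)))"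
        unfolding R_term[of 0] by (simp only: qpoch_0 power_0 power_one mult_1_right mult_1_left mult_ac)
      ultimately have "watson_term q b x y 0 - R * watson_term q b (x * q\<^sup>2) y 0 =
        u 0 * ((1 - L) * (1 - X) * (1 - X * q) * (1 - x * q * B) * (1 - x * q\<^sup>2 * B) * (1 - x * y * q)
    - (1 - x * q\<^sup>2 * B\<^sup>2) * ((1 - L * q\<^sup>2) * (1 - L) * (1 - L * q) * (1 - x * q) * (1 - X)))"
        by (simp only: right_diff_distrib[of "u 0"])
      also have "\<dots> = u 0 * (x * (1 - q * B) * ((- q * (B - 1)) * ((1 - L) * (1 - y) * (1 - X)) * (1 - x * q\<^sup>2 * X)))"
        using watson_certificate_0[of x y B q] unfolding L_def X_def
        by (simp only: power2_eq_square mult_ac)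
      also have "\<dots> = g 0"
        unfolding g_def
        by (simp only: qpoch_0 power_0 power_one mult_1_right mult_1_left mult_ac)
      finally show ?thesis
        by (simp only: atMost_0 sum.insert finite.emptyI empty_iff not_False_eq_True sum.empty add_0_right)
    qed
  next
    case (Suc n)
    define Q where "Q = q * q ^ n"
    define N where "N = (- q * (B - Q)) * (1 - L * Q) * (1 - y * Q) * (1 - X * Q\<^sup>2)"
    define G where "G = (1 - Q) * (1 - X * q * Q) * (1 - y * B * Q) * (1 - x * q\<^sup>2 * B * Q) * (1 - x * y * q * Q\<^sup>2)"
    define f where "f = 1 - x * X * Q\<^sup>2"
    define f' where "f' = 1 - x * q\<^sup>2 * X * Q\<^sup>2"
    define T1 where "T1 = (1 - x) * ((1 - L * Q\<^sup>2) * (1 - X * Q) * (1 - X * q * Q) *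
      (1 - x * q * B * Q) * (1 - x * q\<^sup>2 * B * Q) * (1 - x * y * q * Q\<^sup>2))"
    define T2 where "T2 = (1 - x * q\<^sup>2 * B\<^sup>2) * 
       ((1 - L * q\<^sup>2 * Q\<^sup>2) * (1 - L * Q) * (1 - L * q * Q) * (1 - x * Q) * (1 - x * q * Q) * (1 - X * Q\<^sup>2))"
    have 1: "watson_term q b x y (Suc n) = qpoch (x * q) q n * u (Suc n) * T1"
      unfolding T1_def Q_def A watson_term_def qpoch_Suc_left[of x] power_Suc by (simp only: mult_ac)
    have 2: "R * watson_term q b (x * q\<^sup>2) y (Suc n) = qpoch (x * q) q n * u (Suc n) * T2"
      unfolding T2_def Q_def R_term qpoch_Suc[of "x * q"] power_Suc by (simp only: mult_ac)
    have 3: "T1 - T2 = x * (1 - q * B) * (N * (1 - x * Q) * f' - G * f)"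
      using watson_certificate[of x y B Q q]
      unfolding T1_def T2_def N_def G_def f_def f'_def L_def X_def
      by (simp only: power2_eq_square mult_ac)
    have 4: "g (Suc n) = x * (1 - q * B) * (qpoch (x * q) q n * (1 - x * Q)) * (u (Suc n) * N) * f'"
      unfolding g_def N_def f'_def Q_def qpoch_Suc[of "x * q"] power_Suc by (simp only: mult_ac)
    \<comment> \<open>By \<open>D\<close>, \<open>g n\<close> also becomes a multiple of
      \<open>u (Suc n)\<close>; then all quantities share one factor and the certificate at
      \<open>Q = q^(n+1)\<close> applies.\<close>
    have 5: "u n * ((- q * (B - q^n)) * (1 - L * q^n) * (1 - y * q^n) * (1 - X * (q^n)\<^sup>2)) = u (Suc n) * G"
      unfolding D[symmetric] G_def Q_def ..
    have 6: "g n = x * (1 - q * B) * qpoch (x * q) q n * (u (Suc n) * G) * f"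
      unfolding g_def 5 f_def Q_def by (simp only: power2_eq_square mult_ac)
    have "watson_term q b x y (Suc n) - R * watson_term q b (x * q\<^sup>2) y (Suc n) =
        qpoch (x * q) q n * u (Suc n) * (T1 - T2)"
      unfolding 1 2 by (simp only: right_diff_distrib)
    also have "\<dots> = g (Suc n) - g n"
      unfolding 3 4 6 by algebra
    finally show ?case using Suc by simp
  qed
  have "g \<longlonglongrightarrow> x * (1 - q * B) * qpoch_inf (x * q) q * 
     ((qpoch_inf L q * qpoch_inf b q * qpoch_inf y q * qpoch_inf X (q\<^sup>2) *
     qpoch_inf (q * 0) q * qpoch_inf (X * q\<^sup>2 * 0) q *
     qpoch_inf (x * q ^ 3 * B * 0) q * qpoch_inf (y * q * B * 0) q *
     qpoch_inf (x * y * q ^ 3 * 0) (q\<^sup>2) * 0) * ((- q * (B - 0)) * (1 - L * 0) * (1 - y * 0) * (1 - X * 0\<^sup>2))) * (1 - x * q\<^sup>2 * X * 0\<^sup>2)"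
  proof -
    have qn: "(\<lambda>n. q ^ n) \<longlonglongrightarrow> 0" using q by (rule LIMSEQ_power_zero)
    have q2n: "(\<lambda>n. q ^ (2 * n)) \<longlonglongrightarrow> 0" unfolding power_mult using q2 by (rule LIMSEQ_power_zero)
    have zn: "(\<lambda>n. (- q * B) ^ n) \<longlonglongrightarrow> 0"
      by (rule LIMSEQ_power_zero) (use qb in \<open>auto simp: B_def norm_mult norm_divide divide_less_eq\<close>)
    show ?thesis
      unfolding g_def u_def
      by (intro tendsto_intros qpoch_tendsto_qpoch_inf q q2 qn q2n zn)
  qed
  hence "g \<longlonglongrightarrow> 0" by simp
  hence "(\<lambda>n. \<Sum>m\<le>n. watson_term q b x y m - R * watson_term q b (x * q\<^sup>2) y m) \<longlonglongrightarrow> 0"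
    by (simp add: tel)
  hence "(\<lambda>m. watson_term q b x y m - R * watson_term q b (x * q\<^sup>2) y m) sums 0"
    by (simp add: sums_def_le)
  moreover have "(\<lambda>m. watson_term q b x y m - R * watson_term q b (x * q\<^sup>2) y m) sums
      ((\<Sum>n. watson_term q b x y n) - R * (\<Sum>n. watson_term q b (x * q\<^sup>2) y n))"
    by (intro sums_diff sums_mult summable_sums summable_watson_term q qb)
  ultimately have "(\<Sum>n. watson_term q b x y n) = R * (\<Sum>n. watson_term q b (x * q\<^sup>2) y n)"
    using sums_unique2 by fastforce
  thus ?thesis
    by (simp add: R_def L_def X_def B_def power_divide)
qed


text \<open>After N shifts the series stands at \<open>x q^(2N)\<close>; dominated convergence makes
  it continuous at 0, and the multipliers accumulate to the infinite products.\<close>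

lemma suminf_watson_term_0_left:
  assumes q: "norm q < 1" and qb: "norm q < norm b"
  shows "(\<Sum>n. watson_term q b x y n) =
    qpoch_inf (x * q\<^sup>2 / b\<^sup>2) (q\<^sup>2) * qpoch_inf (x * y / b) q * qpoch_inf (x * q) (q\<^sup>2) *
    qpoch_inf (x * y * q / b\<^sup>2) (q\<^sup>2) * (\<Sum>n. watson_term q b 0 y n)"
proof -
  note q2 = power2_norm_less_1[OF q]
  define W where "W = (\<lambda>x. \<Sum>n. watson_term q b x y n)"
  have *: "W x = qpoch (x * q\<^sup>2 / b\<^sup>2) (q\<^sup>2) N * qpoch (x * y / b) q (2 * N) * qpoch (x * q) (q\<^sup>2) N *
      qpoch (x * y * q / b\<^sup>2) (q\<^sup>2) N * W (x * (q\<^sup>2) ^ N)" for N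
  proof (induction N)
    case (Suc N)
    \<comment> \<open>Each shift by \<open>q^2\<close> contributes two consecutive
      base-\<open>q\<close> factors in \<open>x y / b\<close>, hence the length
      \<open>2 * N\<close>.\<close>
    have s: "qpoch (x * y / b) q (2 * Suc N) =
        qpoch (x * y / b) q (2 * N) * ((1 - x * y / b * (q\<^sup>2) ^ N) * (1 - x * y / b * (q\<^sup>2) ^ N * q))"
    proof -
      have e: "(q\<^sup>2) ^ N = q ^ (2 * N)" "2 * Suc N = Suc (Suc (2 * N))" by (simp_all add: power_mult)
      show ?thesis unfolding e qpoch_Suc by (simp only: power_Suc mult_ac)
    qed
    show ?case
      unfolding Suc s qpoch_Suc
      unfolding W_def suminf_watson_term_rec[OF q qb, of "x * (q\<^sup>2) ^ N"]
      by (simp only: power_Suc mult_ac times_divide_eq_left times_divide_eq_right)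
  qed simp
  have "(\<lambda>N. qpoch (x * q\<^sup>2 / b\<^sup>2) (q\<^sup>2) N * qpoch (x * y / b) q (2 * N) * qpoch (x * q) (q\<^sup>2) N *
      qpoch (x * y * q / b\<^sup>2) (q\<^sup>2) N * W (x * (q\<^sup>2) ^ N)) \<longlonglongrightarrow>
     qpoch_inf (x * q\<^sup>2 / b\<^sup>2) (q\<^sup>2) * qpoch_inf (x * y / b) q * qpoch_inf (x * q) (q\<^sup>2) *
     qpoch_inf (x * y * q / b\<^sup>2) (q\<^sup>2) * W 0"
  proof (intro tendsto_mult qpoch_tendsto_qpoch_inf q2)
    show "(\<lambda>N. qpoch (x * y / b) q (2 * N)) \<longlonglongrightarrow> qpoch_inf (x * y / b) q"
      by (rule filterlim_compose[OF qpoch_tendsto_qpoch_inf[OF q]])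
         (auto intro: filterlim_at_top_mono[OF filterlim_ident])
    have "(\<lambda>N. x * (q\<^sup>2) ^ N) \<longlonglongrightarrow> 0"
      using q2 by (auto intro!: tendsto_mult_right_zero LIMSEQ_power_zero)
    thus "(\<lambda>N. W (x * (q\<^sup>2) ^ N)) \<longlonglongrightarrow> W 0"
      unfolding W_def by (intro tendsto_suminf_watson_term q qb) auto
  qed
  hence "(\<lambda>N::nat. W x) \<longlonglongrightarrow> qpoch_inf (x * q\<^sup>2 / b\<^sup>2) (q\<^sup>2) * qpoch_inf (x * y / b) q *
     qpoch_inf (x * q) (q\<^sup>2) * qpoch_inf (x * y * q / b\<^sup>2) (q\<^sup>2) * W 0"
    by (simp only: *[symmetric])
  thus ?thesis
    unfolding W_def by (rule LIMSEQ_unique[OF tendsto_const])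
qed

text \<open>The factor on the left is the denominator that the \<open>q\<close>-binomial theorem
  leaves at \<open>z = - q / b\<close>; its numerator \<open>(-q;q)_inf\<close> combines with
  \<open>(q;q)_inf\<close> to \<open>(q^2;q^2)_inf\<close>. The remaining factors come from the two
  shifts to 0.\<close>

theorem suminf_watson_term:
  assumes q: "norm q < 1" and qb: "norm q < norm b"
  shows "qpoch_inf (- q / b) q * (\<Sum>n. watson_term q b x y n) =
    qpoch_inf (x * y / b) q * qpoch_inf (x * y * q / b\<^sup>2) (q\<^sup>2) * qpoch_inf (x * q) (q\<^sup>2) *
    qpoch_inf (y * q) (q\<^sup>2) * qpoch_inf (x * q\<^sup>2 / b\<^sup>2) (q\<^sup>2) * qpoch_inf (y * q\<^sup>2 / b\<^sup>2) (q\<^sup>2) *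
    qpoch_inf (q\<^sup>2) (q\<^sup>2)"
proof -
  have b: "b \<noteq> 0" using qb by auto
  have qb': "norm (- q / b) < 1"
    using qb by (simp add: norm_divide divide_less_eq)
  have qn0: "qpoch q q n \<noteq> 0" for n
    by (rule qpoch_nonzero_if_qpoch_inf[OF q qpoch_inf_self_nonzero[OF q]])
  have W00: "qpoch_inf (- q / b) q * (\<Sum>n. watson_term q b 0 0 n) = qpoch_inf (q\<^sup>2) (q\<^sup>2)"
  proof -
    have "watson_term q b 0 0 n = qpoch_inf q q * (qpoch b q n / qpoch q q n * (- q / b) ^ n)" for n
      using qpoch_inf_split[OF q, of q n] qn0[of n]
      by (simp add: watson_term_def watson_core_def)
    moreover have "(\<lambda>n. qpoch_inf q q * (qpoch b q n / qpoch q q n * (- q / b) ^ n)) sums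
        (qpoch_inf q q * (qpoch_inf (b * (- q / b)) q / qpoch_inf (- q / b) q))"
      by (intro sums_mult q_binomial_thm q qb')
    ultimately have "(\<Sum>n. watson_term q b 0 0 n) =
        qpoch_inf q q * (qpoch_inf (- q) q / qpoch_inf (- q / b) q)"
      using b by (simp add: sums_iff)
    thus ?thesis
      using qpoch_inf_square[OF q, of q] qpoch_inf_nonzero_norm[OF q qb'] by simp
  qed
  have "(\<Sum>n. watson_term q b 0 y n) = (\<Sum>n. watson_term q b y 0 n)"
    unfolding watson_term_commute[of q b 0 y] ..
  also have "\<dots> = qpoch_inf (y * q\<^sup>2 / b\<^sup>2) (q\<^sup>2) * qpoch_inf (y * q) (q\<^sup>2) * (\<Sum>n. watson_term q b 0 0 n)"
    using suminf_watson_term_0_left[OF q qb, of y 0] by simp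
  finally show ?thesis
    unfolding suminf_watson_term_0_left[OF q qb, of x y] W00[symmetric] by (simp only: mult_ac)
qed

section \<open>The limit case x = 1 of the summation\<close>

lemma DERIV_qpoch_inf_scale:
  assumes "norm q < 1" "qpoch_inf c q \<noteq> 0"
  shows "((\<lambda>x. qpoch_inf (x * c) q) has_field_derivative (- qlambert c q * qpoch_inf c q)) (at 1)"
proof -
  have "((\<lambda>x. qpoch_inf x q) has_field_derivative deriv (\<lambda>x. qpoch_inf x q) c) (at (1 * c))"
    using holomorphic_derivI[OF holomorphic_qpoch_inf_UNIV[OF assms(1)] open_UNIV, of c] by simp
  moreover have "((\<lambda>x. x * c) has_field_derivative c) (at 1)"
    by (auto intro!: derivative_eq_intros)
  ultimately have "((\<lambda>x. qpoch_inf (x * c) q) has_field_derivative deriv (\<lambda>x. qpoch_inf x q) c * c) (at 1)"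
    by (rule DERIV_chain2)
  moreover have "deriv (\<lambda>x. qpoch_inf x q) c * c = - qlambert c q * qpoch_inf c q"
    using assms by (simp add: qlambert_eq_logderiv)
  ultimately show ?thesis by simp
qed

text \<open>At \<open>x = 1\<close> the closed form \<open>V\<close> and the initial term
  \<open>T\<close> coincide, since all later terms vanish there. So
  \<open>(V x - T x) / (1 - x)\<close> tends to \<open>T' 1 - V' 1\<close>, the common value times a
  difference of logarithmic derivatives, while \<open>(x;q)_n / (1 - x)\<close> tends to
  \<open>(q;q)_{n-1}\<close> in the series.\<close>

theorem suminf_watson_core_at_1:
  assumes q: "norm q < 1" and qb: "norm q < norm b"
    and nz: "qpoch_inf (y / b) q \<noteq> 0" "qpoch_inf (y * q / b\<^sup>2) q \<noteq> 0" "qpoch_inf (y * q) (q\<^sup>2) \<noteq> 0"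
  shows "(\<Sum>n. qpoch q q n * watson_core q b 1 y (Suc n)) =
    watson_core q b 1 y 0 *
      (qlambert (y / b * q) q + qlambert q (q\<^sup>2) + qlambert (q\<^sup>2 / b\<^sup>2) (q\<^sup>2)
       - qlambert (y * q\<^sup>2 / b\<^sup>2) (q\<^sup>2) - qlambert (q / b) q - qlambert (y * q) (q\<^sup>2))"
proof -
  note q2 = power2_norm_less_1[OF q]
  have b: "b \<noteq> 0" using qb by auto
  have qb': "norm (q / b) < 1" "norm (- q / b) < 1"
    using qb by (simp_all add: norm_divide divide_less_eq)
  have qb2: "norm (q\<^sup>2 / b\<^sup>2) < 1"
    using power2_norm_less_1[OF qb'(1)] by (simp add: power_divide)
  have nz': "qpoch_inf (q / b) q \<noteq> 0" "qpoch_inf (q\<^sup>2 / b\<^sup>2) (q\<^sup>2) \<noteq> 0" "qpoch_inf q (q\<^sup>2) \<noteq> 0"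
    "qpoch_inf (- q / b) q \<noteq> 0"
    using qpoch_inf_nonzero_norm[OF q qb'(1)] qpoch_inf_nonzero_norm[OF q2 qb2] qpoch_inf_nonzero_norm[OF q2 q]
      qpoch_inf_nonzero_norm[OF q qb'(2)] by auto
  have nz'': "qpoch_inf (y * q / b\<^sup>2) (q\<^sup>2) \<noteq> 0"
    using nz(2) qpoch_inf_double[OF q, of "y * q / b\<^sup>2"] by auto
  define K where "K = qpoch_inf (y * q) (q\<^sup>2) * qpoch_inf (y * q\<^sup>2 / b\<^sup>2) (q\<^sup>2) * qpoch_inf (q\<^sup>2) (q\<^sup>2) /
      qpoch_inf (- q / b) q"
  define V where "V = (\<lambda>x. K * (qpoch_inf (x * (y / b)) q * qpoch_inf (x * (y * q / b\<^sup>2)) (q\<^sup>2) *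
      qpoch_inf (x * q) (q\<^sup>2) * qpoch_inf (x * (q\<^sup>2 / b\<^sup>2)) (q\<^sup>2)))"
  define K' where "K' = qpoch_inf q q * qpoch_inf (y * q / b) q"
  define T where "T = (\<lambda>x. K' * ((1 - x * (y / b)) * qpoch_inf (x * (y * q / b\<^sup>2)) q * 
      qpoch_inf (x * (q / b)) q * qpoch_inf (x * (y * q)) (q\<^sup>2)))"
  have T: "watson_core q b x y 0 = T x" for x
    by (simp add: watson_core_def T_def K'_def mult_ac)
  have V: "(\<Sum>n. watson_term q b x y n) = V x" for x
    using suminf_watson_term[OF q qb, of x y] nz'(4)
    by (simp add: V_def K_def field_simps)
  have split: "V x = T x + (1 - x) * (\<Sum>n. qpoch (x * q) q n * watson_core q b x y (n + 1))" for x
  proof -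
    have "watson_term q b x y (Suc n) = (1 - x) * (qpoch (x * q) q n * watson_core q b x y (n + 1))" for n
      by (simp add: watson_term_def qpoch_Suc_left)
    moreover have "(\<Sum>n. watson_term q b x y n) = watson_term q b x y 0 + (\<Sum>n. watson_term q b x y (Suc n))"
      using suminf_split_head[OF summable_watson_term[OF q qb, of x y]] by simp
    moreover have "watson_term q b x y 0 = T x"
      by (simp add: watson_term_def T)
    moreover have "summable (\<lambda>n. qpoch (x * q) q n * watson_core q b x y (n + 1))"
      by (rule tendsto_suminf_watson(2)[OF q qb, of sequentially "\<lambda>_. x" x "\<lambda>_. y" y "\<lambda>_. x * q"]) auto
    ultimately show ?thesis
      by (simp add: V suminf_mult)
  qed
  define S where "S = (\<Sum>n. qpoch q q n * watson_core q b 1 y (n + 1))"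
  have "((\<lambda>x. \<Sum>n. qpoch (x * q) q n * watson_core q b x y (n + 1)) \<longlongrightarrow> S) (at 1)"
    unfolding S_def
    by (rule tendsto_suminf_watson(1)[OF q qb]) (auto intro!: tendsto_eq_intros)
  moreover have "eventually (\<lambda>x. (\<Sum>n. qpoch (x * q) q n * watson_core q b x y (n + 1)) =
      - (((V x - T x) - (V 1 - T 1)) / (x - 1))) (at 1)"
    using eventually_neq_at_within[of 1 1 UNIV]
  proof eventually_elim
    case (elim x)
    have "V 1 - T 1 = 0" unfolding split by simp
    thus ?case
      unfolding split[of x] using elim by (simp add: divide_simps) (simp add: algebra_simps)
  qed
  ultimately have lim: "((\<lambda>x. - (((V x - T x) - (V 1 - T 1)) / (x - 1))) \<longlongrightarrow> S) (at 1)"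
    by (rule Lim_transform_eventually)
  note D = DERIV_qpoch_inf_scale
  have DV: "(V has_field_derivative - V 1 * (qlambert (y / b) q + qlambert (y * q / b\<^sup>2) (q\<^sup>2) +
      qlambert q (q\<^sup>2) + qlambert (q\<^sup>2 / b\<^sup>2) (q\<^sup>2))) (at 1)"
    unfolding V_def
    by (rule derivative_eq_intros D[OF q nz(1)] D[OF q2 nz''] D[OF q2 nz'(3)] D[OF q2 nz'(2)] refl)+
       (simp, algebra)
  \<comment> \<open>The contribution of the single factor \<open>1 - x y / b\<close> of
    \<open>T\<close>. It cancels against the first term of \<open>qlambert (y / b) q\<close>, which
    is why the result contains \<open>y / b * q\<close>.\<close>
  define l where "l = y / b / (1 - y / b)"
  have "1 - y / b \<noteq> 0" using nz(1) qpoch_inf_Suc[OF q, of "y / b"] by auto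
  hence l: "(1 - y / b) * l = y / b" by (simp add: l_def)
  have DT: "(T has_field_derivative - T 1 * (l + qlambert (y * q / b\<^sup>2) q +
      qlambert (q / b) q + qlambert (y * q) (q\<^sup>2))) (at 1)"
  proof -
    have "((\<lambda>x. 1 - x * (y / b)) has_field_derivative - ((1 - y / b) * l)) (at 1)"
      unfolding l using b by (auto intro!: derivative_eq_intros)
    note D1 = this
    show ?thesis
      unfolding T_def
      by (rule DERIV_cong[OF DERIV_cmult[OF DERIV_mult[OF DERIV_mult[OF DERIV_mult[OF D1
            D[OF q nz(2)]] D[OF q nz'(1)]] D[OF q2 nz(3)]]]]) (simp only: mult_1, algebra)
  qed
  from DERIV_diff[OF DV DT] have "((\<lambda>x. ((V x - T x) - (V 1 - T 1)) / (x - 1)) \<longlongrightarrow>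
     - V 1 * (qlambert (y / b) q + qlambert (y * q / b\<^sup>2) (q\<^sup>2) + qlambert q (q\<^sup>2) + qlambert (q\<^sup>2 / b\<^sup>2) (q\<^sup>2))
     - (- T 1 * (l + qlambert (y * q / b\<^sup>2) q + qlambert (q / b) q + qlambert (y * q) (q\<^sup>2)))) (at 1)"
    by (simp only: has_field_derivative_iff)
  from tendsto_unique[OF _ lim tendsto_minus[OF this]]
  have "S = V 1 * (qlambert (y / b) q + qlambert (y * q / b\<^sup>2) (q\<^sup>2) + qlambert q (q\<^sup>2) + qlambert (q\<^sup>2 / b\<^sup>2) (q\<^sup>2))
     - T 1 * (l + qlambert (y * q / b\<^sup>2) q + qlambert (q / b) q + qlambert (y * q) (q\<^sup>2))"
    by simp
  moreover have "V 1 = T 1" using split[of 1] by simp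
  moreover have "qlambert (y / b) q = l + qlambert (y / b * q) q"
    unfolding l_def by (rule qlambert_Suc[OF q nz(1)])
  moreover have "qlambert (y * q / b\<^sup>2) q = qlambert (y * q / b\<^sup>2) (q\<^sup>2) + qlambert (y * q\<^sup>2 / b\<^sup>2) (q\<^sup>2)"
    using qlambert_double[OF q nz(2)] by (simp add: power2_eq_square mult_ac)
  ultimately show ?thesis
    unfolding T S_def by (simp add: algebra_simps)
qed

subsection \<open>Theta functions\<close>

text \<open>The modified Jacobi theta function. The triple-product factor \<open>(q;q)_inf\<close>
  is left out and therefore shows up squared in the four-term identity.\<close>

definition qtheta :: "complex \<Rightarrow> complex \<Rightarrow> complex" where
  "qtheta x q = qpoch_inf x q * qpoch_inf (q / x) q"

text \<open>This is \<open>- x \<theta>'(x) / \<theta>(x)\<close>.\<close>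

definition qzeta :: "complex \<Rightarrow> complex \<Rightarrow> complex" where
  "qzeta x q = qlambert x q - qlambert (q / x) q"

lemma qtheta_times_q:
  assumes "norm q < 1" "q \<noteq> 0" "x \<noteq> 0"
  shows "qtheta (q * x) q = - qtheta x q / x"
proof -
  have "qpoch_inf (1 / x) q = (1 - 1 / x) * qpoch_inf (q / x) q"
    "qpoch_inf x q = (1 - x) * qpoch_inf (q * x) q"
    using qpoch_inf_Suc[OF assms(1), of "1 / x"] qpoch_inf_Suc[OF assms(1), of x]
    by (simp_all add: mult.commute)
  moreover have "1 - 1 / x = - (1 - x) / x"
    using assms by (simp add: field_simps)
  ultimately have e: "qpoch_inf (1 / x) q = - (1 - x) / x * qpoch_inf (q / x) q"
    "qpoch_inf x q = (1 - x) * qpoch_inf (q * x) q" by simp_all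
  have "qtheta (q * x) q = qpoch_inf (1 / x) q * qpoch_inf (q * x) q"
    using assms by (simp add: qtheta_def)
  also have "\<dots> = - ((1 - x) * qpoch_inf (q * x) q * qpoch_inf (q / x) q) / x"
    unfolding e(1) by (simp add: algebra_simps)
  finally show ?thesis
    by (simp only: qtheta_def e(2))
qed

lemma qtheta_inverse:
  assumes "norm q < 1" "x \<noteq> 0"
  shows "qtheta (1 / x) q = - qtheta x q / x"
proof -
  have "qpoch_inf (1 / x) q = (1 - 1 / x) * qpoch_inf (q / x) q"
    "qpoch_inf x q = (1 - x) * qpoch_inf (q * x) q"
    using qpoch_inf_Suc[OF assms(1), of "1 / x"] qpoch_inf_Suc[OF assms(1), of x]
    by (simp_all add: mult.commute)
  moreover have "1 - 1 / x = - (1 - x) / x"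
    using assms by (simp add: field_simps)
  ultimately have e: "qpoch_inf (1 / x) q = - (1 - x) / x * qpoch_inf (q / x) q"
    "qpoch_inf x q = (1 - x) * qpoch_inf (q * x) q" by simp_all
  have "qtheta (1 / x) q = qpoch_inf (1 / x) q * qpoch_inf (q * x) q"
    using assms by (simp add: qtheta_def)
  also have "\<dots> = - ((1 - x) * qpoch_inf (q * x) q * qpoch_inf (q / x) q) / x"
    unfolding e(1) by (simp add: algebra_simps)
  finally show ?thesis
    by (simp only: qtheta_def e(2))
qed

lemma qtheta_1 [simp]: "norm q < 1 \<Longrightarrow> qtheta 1 q = 0"
  using qpoch_inf_Suc[of q 1] by (simp add: qtheta_def)

text \<open>The summand 1 is the contribution of the multiplier \<open>- 1 / x\<close> in
  \<open>qtheta_times_q\<close> under \<open>- x d/dx log\<close>. Hence differences of two zeta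
  values are invariant under multiplication of both arguments by \<open>q\<close>.\<close>

lemma qzeta_times_q:
  assumes q: "norm q < 1" "q \<noteq> 0" and x: "x \<noteq> 0" "qtheta x q \<noteq> 0"
  shows "qzeta (q * x) q = qzeta x q + 1"
proof -
  have "qtheta (q * x) q \<noteq> 0" using qtheta_times_q[OF q x(1)] x by simp
  hence nz: "qpoch_inf x q \<noteq> 0" "qpoch_inf (1 / x) q \<noteq> 0" using x q by (auto simp: qtheta_def)
  have "x \<noteq> 1" using x q by auto
  have "qlambert (1 / x) q = 1 / x / (1 - 1 / x) + qlambert (q / x) q"
    "qlambert x q = x / (1 - x) + qlambert (q * x) q"
    using qlambert_Suc[OF q(1) nz(1)] qlambert_Suc[OF q(1) nz(2)] by (simp_all add: mult.commute)
  moreover have "1 / x / (1 - 1 / x) = - 1 - x / (1 - x)"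
    using x \<open>x \<noteq> 1\<close> by (simp add: divide_simps)
  ultimately show ?thesis
    using q x by (simp add: qzeta_def)
qed

lemma qzeta_inverse:
  assumes q: "norm q < 1" "q \<noteq> 0" and x: "x \<noteq> 0" "qtheta x q \<noteq> 0"
  shows "qzeta (1 / x) q = - qzeta x q - 1"
proof -
  have "qtheta (q * x) q \<noteq> 0" using qtheta_times_q[OF q x(1)] x by simp
  hence nz: "qpoch_inf x q \<noteq> 0" "qpoch_inf (1 / x) q \<noteq> 0" using x q by (auto simp: qtheta_def)
  have "x \<noteq> 1" using x q by auto
  have "qlambert (1 / x) q = 1 / x / (1 - 1 / x) + qlambert (q / x) q"
    "qlambert x q = x / (1 - x) + qlambert (q * x) q"
    using qlambert_Suc[OF q(1) nz(1)] qlambert_Suc[OF q(1) nz(2)] by (simp_all add: mult.commute)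
  moreover have "1 / x / (1 - 1 / x) = - 1 - x / (1 - x)"
    using x \<open>x \<noteq> 1\<close> by (simp add: divide_simps)
  ultimately show ?thesis
    using q x by (simp add: qzeta_def)
qed

lemma qtheta_square:
  assumes "norm q < 1"
  shows "qtheta x q * qtheta (- x) q = qtheta (x\<^sup>2) (q\<^sup>2)"
  using qpoch_inf_square[OF assms, of x, symmetric] qpoch_inf_square[OF assms, of "q / x", symmetric]
  by (simp add: qtheta_def power_divide)

lemma qzeta_square:
  assumes "norm q < 1" "qtheta (x\<^sup>2) (q\<^sup>2) \<noteq> 0"
  shows "qzeta x q + qzeta (- x) q = 2 * qzeta (x\<^sup>2) (q\<^sup>2)"
proof -
  have "qpoch_inf (x\<^sup>2) (q\<^sup>2) \<noteq> 0" "qpoch_inf ((q / x)\<^sup>2) (q\<^sup>2) \<noteq> 0"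
    using assms by (auto simp: qtheta_def power_divide)
  from this[THEN qlambert_square[OF assms(1)]] show ?thesis
    by (simp add: qzeta_def power_divide algebra_simps)
qed

lemma qzeta_Suc:
  assumes "norm q < 1" "qpoch_inf x q \<noteq> 0"
  shows "qzeta x q = x / (1 - x) + qlambert (x * q) q - qlambert (q / x) q"
  using qlambert_Suc[OF assms] by (simp add: qzeta_def)

lemma qtheta_eq_0D:
  assumes q: "norm q < 1" "q \<noteq> 0" and x: "x \<noteq> 0" "qtheta x q = 0"
  obtains n where "x = q ^ n" | n where "x = 1 / q ^ n"
proof -
  from x consider n where "x * q ^ n = 1" | n where "q / x * q ^ n = 1"
    by (auto simp: qtheta_def qpoch_inf_eq_0_iff[OF q(1)])
  thus ?thesis
  proof cases
    case (1 n)
    with q have "x = 1 / q ^ n" by (simp add: field_simps)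
    thus ?thesis by (rule that(2))
  next
    case (2 n)
    with q x have "x = q ^ Suc n" by (simp add: field_simps)
    thus ?thesis by (rule that(1))
  qed
qed

lemma analytic_qtheta [analytic_intros]:
  assumes "norm q < 1" "f analytic_on A" "\<And>x. x \<in> A \<Longrightarrow> f x \<noteq> 0"
  shows "(\<lambda>x. qtheta (f x) q) analytic_on A"
  unfolding qtheta_def by (intro analytic_intros assms)

lemma analytic_qlambert_at:
  assumes q: "norm q < 1" and x: "qpoch_inf x q \<noteq> 0"
  shows "(\<lambda>x. qlambert x q) analytic_on {x}"
proof -
  define A where "A = {x. qpoch_inf x q \<noteq> 0}"
  have "open A"
    unfolding A_def by (intro open_Collect_neq continuous_intros q)
  have "(\<lambda>x. - x * deriv (\<lambda>x. qpoch_inf x q) x / qpoch_inf x q) holomorphic_on A"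
    using holomorphic_on_subset[OF holomorphic_deriv[OF holomorphic_qpoch_inf_UNIV[OF q] open_UNIV], of A]
    by (intro holomorphic_intros q) (use \<open>open A\<close> in \<open>auto simp: A_def\<close>)
  hence "(\<lambda>x. qlambert x q) holomorphic_on A"
    by (rule holomorphic_transform) (auto simp: A_def qlambert_eq_logderiv[OF q])
  thus ?thesis
    using \<open>open A\<close> x by (auto simp: analytic_at A_def)
qed

lemma analytic_qlambert [analytic_intros]:
  assumes "norm q < 1" "f analytic_on A" "\<And>x. x \<in> A \<Longrightarrow> qpoch_inf (f x) q \<noteq> 0"
  shows "(\<lambda>x. qlambert (f x) q) analytic_on A"
proof -
  have "(\<lambda>x. qlambert x q) analytic_on f ` A"
    using analytic_qlambert_at[OF assms(1)] assms(3) by (subst analytic_on_analytic_at) auto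
  from analytic_on_compose[OF assms(2) this] show ?thesis by (simp add: o_def)
qed

lemma analytic_qzeta [analytic_intros]:
  assumes "norm q < 1" "f analytic_on A" "\<And>x. x \<in> A \<Longrightarrow> f x \<noteq> 0" "\<And>x. x \<in> A \<Longrightarrow> qtheta (f x) q \<noteq> 0"
  shows "(\<lambda>x. qzeta (f x) q) analytic_on A"
proof -
  have "qpoch_inf (f x) q \<noteq> 0" "qpoch_inf (q / f x) q \<noteq> 0" if "x \<in> A" for x
    using assms(4)[OF that] by (auto simp: qtheta_def)
  thus ?thesis
    unfolding qzeta_def by (intro analytic_intros assms) auto
qed

section \<open>Functions on the punctured plane invariant under x |-> p x\<close>

lemma obtain_power_in_annulus:
  fixes p x :: complex
  assumes p: "norm p < 1" "p \<noteq> 0" and x: "x \<noteq> 0"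
  obtains n where "norm p \<le> norm (x / p ^ n)" "norm (x / p ^ n) \<le> 1"
    | n where "norm p \<le> norm (x * p ^ n)" "norm (x * p ^ n) \<le> 1"
proof (cases "norm x \<le> 1")
  case True
  \<comment> \<open>Minimality gives the second inequality through the predecessor of
    \<open>n\<close>, which exists because \<open>norm x \<le> 1\<close>.\<close>
  define n where "n = (LEAST n. norm p ^ n < norm x)"
  have ex: "\<exists>n. norm p ^ n < norm x" using p x by (intro real_arch_pow_inv) auto
  have n: "norm p ^ n < norm x" unfolding n_def by (rule LeastI_ex[OF ex])
  have "n \<noteq> 0" using n True by (intro notI) simp
  then obtain m where m: "n = Suc m" by (cases n) auto
  have "\<not> norm p ^ m < norm x"
    using not_less_Least[of m "\<lambda>n. norm p ^ n < norm x"] m by (simp add: n_def)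
  thus ?thesis
    using n p by (intro that(1)[of m]) (auto simp: m norm_divide norm_power divide_simps mult_ac)
next
  case False
  define n where "n = (LEAST n. norm p ^ n < 1 / norm x)"
  have ex: "\<exists>n. norm p ^ n < 1 / norm x" using p x by (intro real_arch_pow_inv) auto
  have n: "norm p ^ n < 1 / norm x" unfolding n_def by (rule LeastI_ex[OF ex])
  have "1 / norm x < 1" using False by (simp add: divide_less_eq_1)
  hence "n \<noteq> 0" using n by (intro notI) simp
  then obtain m where m: "n = Suc m" by (cases n) auto
  have *: "\<not> norm p ^ m < 1 / norm x"
    using not_less_Least[of m "\<lambda>n. norm p ^ n < 1 / norm x"] m by (simp add: n_def)
  have "norm p * 1 \<le> norm p * (norm x * norm p ^ m)"
    using * x by (intro mult_left_mono) (auto simp: field_simps)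
  thus ?thesis
    using n x by (intro that(2)[of n]) (auto simp: m norm_mult norm_power field_simps)
qed

text \<open>An elliptic function without poles: the compact annulus
  \<open>norm p \<le> norm x \<le> 1\<close> meets every orbit, so \<open>g\<close> is bounded, and
  \<open>g \<circ> exp\<close> is a bounded entire function.\<close>

lemma multiplicatively_periodic_imp_constant:
  assumes p: "norm p < 1" "p \<noteq> 0"
    and g: "g holomorphic_on - {0}" and per: "\<And>x. x \<noteq> 0 \<Longrightarrow> g (p * x) = g x"
    and xy: "x \<noteq> 0" "y \<noteq> 0"
  shows "g x = g y"
proof -
  have per': "g (x * p ^ n) = g x" if "x \<noteq> 0" for x n
    using that per[of "x * p ^ k" for k] p by (induction n) (simp_all add: mult_ac)
  have per'': "g (x / p ^ n) = g x" if "x \<noteq> 0" for x n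
    using that per'[of "x / p ^ n" n] p by simp
  define A where "A = cball (0 :: complex) 1 \<inter> - ball 0 (norm p)"
  have "compact A" unfolding A_def by (intro compact_Int_closed) auto
  moreover have "continuous_on A g"
    by (rule continuous_on_subset[OF holomorphic_on_imp_continuous_on[OF g]]) (use p in \<open>auto simp: A_def\<close>)
  ultimately have "bounded (g ` A)"
    by (intro compact_imp_bounded compact_continuous_image)
  then obtain K where "\<forall>x\<in>A. norm (g x) \<le> K"
    by (auto simp: bounded_iff)
  hence K: "norm (g x) \<le> K" if "norm p \<le> norm x" "norm x \<le> 1" for x
    using that by (simp add: A_def dist_norm)
  have "norm (g x) \<le> K" if x: "x \<noteq> 0" for x
    using p x by (rule obtain_power_in_annulus) (use K per'[OF x] per''[OF x] in metis)+
  hence "norm ((g \<circ> exp) u) \<le> K" for u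
    by simp
  hence "bounded (range (g \<circ> exp))"
    unfolding bounded_iff by blast
  moreover have "(g \<circ> exp) holomorphic_on UNIV"
    by (rule holomorphic_on_compose_gen[OF _ g]) (auto intro: holomorphic_intros)
  ultimately have "(g \<circ> exp) constant_on UNIV"
    by (intro Liouville_theorem)
  then obtain c where "g (exp u) = c" for u by (auto simp: constant_on_def)
  from this[of "Ln x"] this[of "Ln y"] show ?thesis using xy by simp
qed


text \<open>
  As a function of \<open>x\<close>, the difference of the two sides is invariant under \<open>x \<mapsto> p x\<close> and under
  \<open>x \<mapsto> 1 / (w x)\<close> with \<open>w = y z\<close>. The singularity at \<open>1\<close> is removable, hence so are all of
  them, and Liouville's theorem applies; the difference vanishes at \<open>x = 1 / y\<close>.
\<close>

theorem qzeta_four_term: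
  assumes p: "norm p < 1" "p \<noteq> 0" and nz: "x \<noteq> 0" "y \<noteq> 0" "z \<noteq> 0"
    and theta: "qtheta x p \<noteq> 0" "qtheta y p \<noteq> 0" "qtheta z p \<noteq> 0" "qtheta (y * z) p \<noteq> 0"
      "qtheta (x * y * z) p \<noteq> 0"
  shows "qzeta x p - qzeta (x * y * z) p + qzeta z p - qzeta (1 / y) p =
     (qpoch_inf p p)\<^sup>2 * qtheta (x * y) p * qtheta (x * z) p * qtheta (y * z) p /
     (qtheta x p * qtheta y p * qtheta z p * qtheta (x * y * z) p)"
proof -
  define w where "w = y * z"
  have w: "w \<noteq> 0" "qtheta w p \<noteq> 0" using nz theta by (auto simp: w_def)
  \<comment> \<open>With this constant \<open>f (1 / y) = 0\<close>: there \<open>w * x = z\<close>,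
    and the product term contains \<open>qtheta 1 p = 0\<close>.\<close>
  define c where "c = qzeta z p - qzeta (1 / y) p"
  \<comment> \<open>Chosen so that the simple poles of \<open>qzeta x p\<close> and of the product
    term cancel at \<open>x = 1\<close>; removing \<open>1 - x\<close> from
    \<open>qtheta x p\<close> leaves \<open>(p;p)_inf\<close> squared there.\<close>
  define C where "C = (qpoch_inf p p)\<^sup>2 * qtheta w p / (qtheta y p * qtheta z p)"
  define f where "f = (\<lambda>x. qzeta x p - qzeta (w * x) p + c -
      C * qtheta (x * y) p * qtheta (x * z) p / (qtheta x p * qtheta (w * x) p))"
  define D where "D = (\<lambda>x. qtheta x p * qtheta (w * x) p)"
  define good where "good = (\<lambda>z. \<exists>F. F analytic_on {z} \<and> eventually (\<lambda>x. f x = F x) (at z))"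
  have theta_q: "qtheta (p * x) p = - qtheta x p / x" if "x \<noteq> 0" for x
    by (rule qtheta_times_q[OF p that])
  have theta_inv: "qtheta (1 / x) p = - qtheta x p / x" if "x \<noteq> 0" for x
    by (rule qtheta_inverse[OF p(1) that])

  \<comment> \<open>Identity theorem: \<open>D\<close> is not identically zero, since
    \<open>D (1 / y) \<noteq> 0\<close>, so its zeros, the only possible singularities of
    \<open>f\<close> away from 0, are isolated.\<close>
  have ev_D: "eventually (\<lambda>x. D x \<noteq> 0 \<and> x \<noteq> 0) (at z)" if "z \<noteq> 0" for z
  proof -
    have "D analytic_on - {0}"
      unfolding D_def by (intro analytic_intros p) (use w in auto)
    hence "D holomorphic_on - {0}" by (rule analytic_imp_holomorphic)
    moreover have "connected (- {0 :: complex})"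
      by (rule connected_punctured_universe) auto
    moreover have "D (1 / y) \<noteq> 0"
      using theta_inv[of y] nz theta by (simp add: D_def w_def)
    ultimately have "eventually (\<lambda>x. D x \<noteq> 0 \<and> x \<in> - {0}) (at z)"
      using that nz by (intro non_zero_neighbour_alt[where \<beta> = "1 / y"]) auto
    thus ?thesis by simp
  qed

  have f_q: "f (p * x) = f x" if "x \<noteq> 0" "D x \<noteq> 0" for x
  proof -
    have 1: "qzeta (p * x) p = qzeta x p + 1" "qzeta (w * (p * x)) p = qzeta (w * x) p + 1"
      using qzeta_times_q[OF p, of x] qzeta_times_q[OF p, of "w * x"] that w
      by (simp_all add: D_def mult_ac)
    have 2: "qtheta (p * x) p = - qtheta x p / x" "qtheta (w * (p * x)) p = - qtheta (w * x) p / (w * x)"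
      "qtheta (p * x * y) p = - qtheta (x * y) p / (x * y)" "qtheta (p * x * z) p = - qtheta (x * z) p / (x * z)"
      using theta_q[of x] theta_q[of "w * x"] theta_q[of "x * y"] theta_q[of "x * z"] that nz w
      by (simp_all add: mult_ac)
    show ?thesis
      unfolding f_def 1 2 using that nz w by (simp add: w_def D_def)
  qed
  \<comment> \<open>The involution exchanges \<open>x\<close> with \<open>w x\<close> and, up to
    inversion, \<open>x y\<close> with \<open>x z\<close>. It carries the poles coming from
    \<open>qtheta (w * x) p\<close> to those of \<open>qtheta x p\<close>.\<close>
  have f_inv: "f (1 / (w * x)) = f x" if "x \<noteq> 0" "D x \<noteq> 0" for x
  proof -
    have 1: "qzeta (1 / (w * x)) p = - qzeta (w * x) p - 1" "qzeta (w * (1 / (w * x))) p = - qzeta x p - 1"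
      using qzeta_inverse[OF p, of x] qzeta_inverse[OF p, of "w * x"] that w
      by (simp_all add: D_def)
    have 2: "qtheta (1 / (w * x)) p = - qtheta (w * x) p / (w * x)" "qtheta (w * (1 / (w * x))) p = - qtheta x p / x"
      "qtheta (1 / (w * x) * y) p = - qtheta (x * z) p / (x * z)" "qtheta (1 / (w * x) * z) p = - qtheta (x * y) p / (x * y)"
      using theta_inv[of x] theta_inv[of "w * x"] theta_inv[of "x * y"] theta_inv[of "x * z"] that nz w
      by (simp_all add: mult_ac w_def)
    show ?thesis
      unfolding f_def 1 2 using that nz w by (simp add: w_def D_def) (simp add: mult_ac)
  qed

  have good_D: "f analytic_on {x}" if "x \<noteq> 0" "D x \<noteq> 0" for x
    unfolding f_def by (intro analytic_intros p) (use that nz w in \<open>auto simp: D_def\<close>)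

  have good_1: "good 1"
  proof -
    define \<theta> where "\<theta> = (\<lambda>x. qpoch_inf (x * p) p * qpoch_inf (p / x) p)"
    \<comment> \<open>After the factor \<open>1 - x\<close> is split off, the polar part of
      \<open>f\<close> at 1 is \<open>h x / (x - 1)\<close>, and the choice of \<open>C\<close> says
      \<open>h 1 = 0\<close>.\<close>
    define h where "h = (\<lambda>x. C * qtheta (x * y) p * qtheta (x * z) p / (\<theta> x * qtheta (w * x) p) - x)"
    define F where "F = (\<lambda>x. (if x = 1 then deriv h 1 else h x / (x - 1)) + qlambert (x * p) p -
        qlambert (p / x) p - qzeta (w * x) p + c)"
    have \<theta>1: "\<theta> 1 \<noteq> 0" using qpoch_inf_self_nonzero[OF p(1)] by (simp add: \<theta>_def)
    have h: "h analytic_on {1}"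
      unfolding h_def \<theta>_def by (intro analytic_intros p) (use \<theta>1 w nz in \<open>auto simp: \<theta>_def\<close>)
    have "h 1 = 0"
      using qpoch_inf_self_nonzero[OF p(1)] theta w
      by (simp add: h_def \<theta>_def C_def power2_eq_square)
    have "(\<lambda>x. if x = 1 then deriv h 1 else h x / (x - 1)) analytic_on {1}"
      by (rule pole_theorem_analytic_0[OF h, of 1]) (use \<open>h 1 = 0\<close> in \<open>auto intro!: exI[of _ 1]\<close>)
    hence "F analytic_on {1}"
      unfolding F_def by (intro analytic_intros p) (use \<theta>1 w nz in \<open>auto simp: \<theta>_def\<close>)
    moreover have "eventually (\<lambda>x. f x = F x) (at 1)"
      using ev_D[of 1, simplified] eventually_neq_at_within[of 1 1 UNIV]
    proof eventually_elim
      case (elim x)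
      have x: "qpoch_inf x p \<noteq> 0" using elim by (auto simp: D_def qtheta_def)
      have 1: "qlambert x p = x / (1 - x) + qlambert (x * p) p"
        by (rule qlambert_Suc[OF p(1) x])
      have 2: "qtheta x p = (1 - x) * \<theta> x"
        unfolding qtheta_def \<theta>_def using qpoch_inf_Suc[OF p(1), of x] by simp
      have "\<theta> x \<noteq> 0" "qtheta (w * x) p \<noteq> 0"
        using elim 2 by (auto simp: D_def)
      moreover have "x - 1 \<noteq> 0" "1 - x \<noteq> 0" using elim by auto
      ultimately have "h x / (x - 1) = x / (1 - x) - C * qtheta (x * y) p * qtheta (x * z) p / (qtheta x p * qtheta (w * x) p)"
        unfolding h_def 2 by (simp add: divide_simps) (simp add: algebra_simps)
      thus ?case
        using elim by (simp add: F_def f_def qzeta_def[of x] 1)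
    qed
    ultimately show ?thesis by (auto simp: good_def)
  qed

  \<comment> \<open>Removability is transported along a symmetry of \<open>f\<close>. Separating
    \<open>z\<close> from other points makes the symmetry map punctured neighbourhoods into
    punctured ones, so that an equality holding only near, not at, \<open>\<psi> z\<close>
    suffices.\<close>
  have good_trans: "good z" 
    if z: "good (\<psi> z)" "z \<noteq> 0" and \<psi>: "\<psi> analytic_on {z}" "\<And>x. x \<noteq> 0 \<Longrightarrow> x \<noteq> z \<Longrightarrow> \<psi> x \<noteq> \<psi> z"
      and inv: "\<And>x. x \<noteq> 0 \<Longrightarrow> D x \<noteq> 0 \<Longrightarrow> f (\<psi> x) = f x" for z \<psi>
  proof -
    obtain F where F: "F analytic_on {\<psi> z}" "eventually (\<lambda>x. f x = F x) (at (\<psi> z))"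
      using z by (auto simp: good_def)
    have "eventually (\<lambda>x. x \<noteq> z \<and> D x \<noteq> 0 \<and> x \<noteq> 0) (at z)"
      using ev_D[OF z(2)] eventually_neq_at_within[of z z UNIV] by eventually_elim auto
    note ev = this
    have "isCont \<psi> z" by (rule analytic_at_imp_isCont[OF \<psi>(1)])
    hence "filterlim \<psi> (at (\<psi> z)) (at z)"
      unfolding filterlim_at isCont_def using ev by (auto elim!: eventually_mono simp: \<psi>)
    from eventually_compose_filterlim[OF F(2) this]
    have "eventually (\<lambda>x. f (\<psi> x) = F (\<psi> x)) (at z)" .
    with ev have "eventually (\<lambda>x. f x = (F \<circ> \<psi>) x) (at z)"
      by eventually_elim (auto simp: inv)
    moreover have "(F \<circ> \<psi>) analytic_on {z}"
      using F \<psi> by (intro analytic_on_compose) auto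
    ultimately show ?thesis unfolding good_def by blast
  qed

  have good_mult: "good z" if "good (p * z)" "z \<noteq> 0" for z
    by (rule good_trans[where \<psi> = "\<lambda>x. p * x"]) (use that p f_q in \<open>auto intro!: analytic_intros\<close>)
  have good_div: "good z" if "good (z / p)" "z \<noteq> 0" for z
  proof (rule good_trans[where \<psi> = "\<lambda>x. x / p"])
    show "f (x / p) = f x" if "x \<noteq> 0" "D x \<noteq> 0" for x
    proof -
      have "D (x / p) \<noteq> 0"
        using theta_q[of "x / p"] theta_q[of "w * x / p"] that p w by (auto simp: D_def)
      thus ?thesis using f_q[of "x / p"] that p by simp
    qed
  qed (use that p in \<open>auto intro!: analytic_intros\<close>)
  have good_inv: "good z" if "good (1 / (w * z))" "z \<noteq> 0" for z
  proof (rule good_trans[where \<psi> = "\<lambda>x. 1 / (w * x)"])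
    show "(\<lambda>x. 1 / (w * x)) analytic_on {z}"
      by (intro analytic_intros) (use that w in auto)
    show "1 / (w * x) \<noteq> 1 / (w * z)" if "x \<noteq> z" for x
      using that w by simp
  qed (use that f_inv in blast)+
  have good_pow: "good (p ^ n)" for n
  proof (induction n)
    case (Suc n)
    have "p ^ Suc n / p = p ^ n" using p by simp
    with Suc show ?case using p by (metis good_div power_not_zero)
  qed (use good_1 in simp)
  have good_pow': "good (1 / p ^ n)" for n
  proof (induction n)
    case (Suc n)
    have "p * (1 / p ^ Suc n) = 1 / p ^ n" "1 / p ^ Suc n \<noteq> 0" using p by simp_all
    with Suc show ?case by (metis good_mult)
  qed (use good_1 in simp)
  have good_zero: "good z" if "z \<noteq> 0" "qtheta z p = 0" for z
    using p that by (rule qtheta_eq_0D) (use good_pow good_pow' in auto)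
  have good: "good z" if z: "z \<noteq> 0" for z
  proof -
    consider "qtheta z p = 0" | "qtheta (w * z) p = 0" | "D z \<noteq> 0" by (auto simp: D_def)
    thus ?thesis
    proof cases
      case 1
      thus ?thesis by (rule good_zero[OF z])
    next
      case 2
      thus ?thesis
        using theta_inv[of "w * z"] w z by (intro good_inv[OF good_zero]) auto
    next
      case 3
      from good_D[OF z this] show ?thesis by (auto simp: good_def intro!: exI[of _ f])
    qed
  qed

  define g where "g = remove_sings f"
  have lim: "f \<midarrow>z\<rightarrow> g z" and ana: "g analytic_on {z}" if z: "z \<noteq> 0" for z
  proof -
    obtain F where F: "F analytic_on {z}" "eventually (\<lambda>x. f x = F x) (at z)"
      using good[OF z] by (auto simp: good_def)
    have "F \<midarrow>z\<rightarrow> F z"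
      using analytic_at_imp_isCont[OF F(1)] by (simp add: isCont_def)
    hence f_lim: "f \<midarrow>z\<rightarrow> F z"
      using F(2) by (simp cong: filterlim_cong)
    thus "f \<midarrow>z\<rightarrow> g z" 
      unfolding g_def using remove_sings_eqI[OF f_lim] by simp
    have "isolated_singularity_at F z"
      using F(1) by (rule isolated_singularity_at_analytic)
    hence "isolated_singularity_at f z"
      using isolated_singularity_at_cong[OF F(2) refl] by simp
    thus "g analytic_on {z}"
      unfolding g_def by (rule remove_sings_analytic_at[OF _ f_lim])
  qed
  have "g analytic_on - {0}"
    by (subst analytic_on_analytic_at) (auto intro: ana)
  hence g_holo: "g holomorphic_on - {0}" by (rule analytic_imp_holomorphic)
  have g_q: "g (p * x) = g x" if x: "x \<noteq> 0" for x
  proof (rule LIM_unique)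
    show "f \<midarrow>x\<rightarrow> g x" by (rule lim[OF x])
    have "filterlim (\<lambda>u. p * u) (at (p * x)) (at x)"
      unfolding filterlim_at using p by (auto intro!: tendsto_intros simp: eventually_at_filter)
    from filterlim_compose[OF lim this]
    have "((\<lambda>u. f (p * u)) \<longlongrightarrow> g (p * x)) (at x)"
      using p x by simp
    moreover have "eventually (\<lambda>u. f (p * u) = f u) (at x)"
      using ev_D[OF x] by eventually_elim (auto simp: f_q)
    ultimately show "f \<midarrow>x\<rightarrow> g (p * x)"
      by (simp cong: filterlim_cong)
  qed
  have g_eq: "g x = f x" if "x \<noteq> 0" "D x \<noteq> 0" for x
    unfolding g_def by (rule remove_sings_at_analytic[OF good_D[OF that]])
  have "D x \<noteq> 0" using theta by (simp add: D_def w_def mult_ac)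
  hence "f x = g x" using nz by (simp add: g_eq)
  also have "\<dots> = g (1 / y)"
    using nz by (intro multiplicatively_periodic_imp_constant[OF p g_holo g_q]) auto
  also have "\<dots> = f (1 / y)"
    using nz theta theta_inv[of y] by (intro g_eq) (auto simp: D_def w_def)
  also have "\<dots> = 0"
    using nz p by (simp add: f_def c_def w_def)
  finally show ?thesis
    by (simp add: f_def c_def C_def w_def mult_ac add_diff_eq)
qed

subsection \<open>Interchange of summation\<close>

text \<open>Reversing the sum puts the geometric weight on the fixed index: the terms are
  \<open>c (N - 1 - k) r^(k+1)\<close>, each tends to 0 for fixed k, and \<open>B r^(k+1)\<close>
  dominates them.\<close>

lemma convolution_geometric_tendsto_0:
  fixes c :: "nat \<Rightarrow> real"
  assumes c: "c \<longlonglongrightarrow> 0" and r: "0 \<le> r" "r < 1"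
  shows "(\<lambda>N. \<Sum>j<N. c j * r ^ (N - j)) \<longlonglongrightarrow> 0"
proof -
  obtain B where B: "\<And>n. norm (c n) \<le> B"
    using convergent_imp_Bseq[OF convergentI[OF c]] by (auto simp: Bseq_def)
  define f where "f = (\<lambda>k N. if k < N then c (N - Suc k) * r ^ Suc k else 0)"
  have "(\<lambda>N. suminf (\<lambda>k. f k N)) \<longlonglongrightarrow> suminf (\<lambda>k. 0 :: real)"
  proof (rule tannerys_theorem[THEN conjunct2, THEN conjunct2])
    show "f k \<longlonglongrightarrow> 0" for k
    proof (rule Lim_transform_eventually)
      have "(\<lambda>N. c (N - Suc k)) \<longlonglongrightarrow> 0"
        using c by (rule filterlim_compose) (rule filterlim_minus_const_nat_at_top)
      from tendsto_mult_left_zero[OF this, of "r ^ Suc k"]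
      show "(\<lambda>N. c (N - Suc k) * r ^ Suc k) \<longlonglongrightarrow> 0" .
      show "eventually (\<lambda>N. c (N - Suc k) * r ^ Suc k = f k N) sequentially"
        using eventually_gt_at_top[of k] by eventually_elim (simp add: f_def)
    qed
    have "norm (f k n) \<le> B * r ^ Suc k" for k n
    proof -
      have "0 \<le> B" using B[of 0] norm_ge_zero order_trans by blast
      thus ?thesis
        using B[of "n - Suc k"] r by (auto simp: f_def abs_mult intro!: mult_right_mono)
    qed
    thus "eventually (\<lambda>(k, n). norm (f k n) \<le> B * r ^ Suc k) (at_top \<times>\<^sub>F sequentially)"
      by (intro always_eventually) auto
    show "summable (\<lambda>k. B * r ^ Suc k)"
      using r by (auto intro!: summable_mult summable_geometric)
  qed auto
  moreover have "suminf (\<lambda>k. f k N) = (\<Sum>j<N. c j * r ^ (N - j))" for N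
  proof -
    have "suminf (\<lambda>k. f k N) = (\<Sum>k<N. f k N)"
      by (rule suminf_finite) (auto simp: f_def)
    also have "\<dots> = (\<Sum>j<N. f (N - Suc j) N)"
      by (rule sum.nat_diff_reindex[symmetric])
    also have "\<dots> = (\<Sum>j<N. c j * r ^ (N - j))"
      by (rule sum.cong) (auto simp: f_def Suc_diff_Suc)
    finally show ?thesis .
  qed
  ultimately show ?thesis by simp
qed

text \<open>
  Only \<open>\<gamma>\<^sub>j r\<^sup>j \<longlonglongrightarrow> 0\<close> is available, so the double series need not converge absolutely; the tails are
  instead controlled by a convolution of a null sequence with a geometric one.
\<close>

lemma triangular_sum_interchange:
  fixes A :: "nat \<Rightarrow> nat \<Rightarrow> complex" and u :: "nat \<Rightarrow> complex" and g :: "nat \<Rightarrow> real"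
  assumes A: "\<And>n j. j \<le> n \<Longrightarrow> norm (A n j) \<le> C * g j * r ^ n"
    and r: "0 \<le> r" "r < 1" and C: "0 \<le> C"
    and u: "(\<lambda>j. g j * norm (u j) * r ^ j) \<longlonglongrightarrow> 0"
  shows "(\<lambda>N. (\<Sum>n<N. \<Sum>j\<le>n. A n j * u j) - (\<Sum>j<N. (\<Sum>m. A (j + m) j) * u j)) \<longlonglongrightarrow> 0"
proof (rule Lim_null_comparison)
  have sm: "summable (\<lambda>m. A (j + m) j)" for j
  proof (rule summable_comparison_test)
    show "\<exists>N. \<forall>m\<ge>N. norm (A (j + m) j) \<le> C * g j * r ^ j * r ^ m"
      using A[of j "j + m" for m] by (auto simp: power_add mult_ac)
    show "summable (\<lambda>m. C * g j * r ^ j * r ^ m)"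
      using r by (auto intro!: summable_mult summable_geometric)
  qed
  have swap: "(\<Sum>n<N. \<Sum>j\<le>n. A n j * u j) = (\<Sum>j<N. (\<Sum>m<N - j. A (j + m) j) * u j)" for N
  proof (induction N)
    case (Suc N)
    have "(\<Sum>j<Suc N. (\<Sum>m<Suc N - j. A (j + m) j) * u j) =
        (\<Sum>j<N. (\<Sum>m<Suc N - j. A (j + m) j) * u j) + A N N * u N" by simp
    also have "(\<Sum>j<N. (\<Sum>m<Suc N - j. A (j + m) j) * u j) =
        (\<Sum>j<N. (\<Sum>m<N - j. A (j + m) j) * u j + A N j * u j)"
      by (rule sum.cong) (auto simp: Suc_diff_le algebra_simps)
    finally show ?case
      using Suc by (simp add: sum.distrib lessThan_Suc_atMost[symmetric])
  qed simp
  \<comment> \<open>The part of the j-th column that the first \<open>N\<close> rows miss starts at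
    row \<open>N\<close>. Writing its bound with \<open>r^N = r^j r^(N-j)\<close> produces the
    convolution.\<close>
  have tail: "norm (\<Sum>m. A (j + (m + (N - j))) j) \<le> C * g j * r ^ N / (1 - r)" if "j < N" for j N
  proof -
    have le: "norm (A (j + (m + (N - j))) j) \<le> C * g j * r ^ N * r ^ m" for m
      using A[of j "j + (m + (N - j))"] that by (simp add: power_add mult_ac)
    have s: "summable (\<lambda>m. C * g j * r ^ N * r ^ m)"
      using r by (auto intro!: summable_mult summable_geometric)
    have "norm (\<Sum>m. A (j + (m + (N - j))) j) \<le> (\<Sum>m. C * g j * r ^ N * r ^ m)"
      by (rule norm_suminf_le[OF le s])
    also have "\<dots> = C * g j * r ^ N / (1 - r)"
      using r by (subst suminf_mult) (auto simp: suminf_geometric intro: summable_geometric)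
    finally show ?thesis .
  qed
  show "eventually (\<lambda>N. norm ((\<Sum>n<N. \<Sum>j\<le>n. A n j * u j) - (\<Sum>j<N. (\<Sum>m. A (j + m) j) * u j)) \<le>
      C / (1 - r) * (\<Sum>j<N. g j * norm (u j) * r ^ j * r ^ (N - j))) sequentially"
  proof (intro always_eventually allI)
    fix N
    have "(\<Sum>n<N. \<Sum>j\<le>n. A n j * u j) - (\<Sum>j<N. (\<Sum>m. A (j + m) j) * u j) =
        (\<Sum>j<N. - (\<Sum>m. A (j + (m + (N - j))) j) * u j)"
    proof -
      have "(\<Sum>m. A (j + m) j) = (\<Sum>m. A (j + (m + (N - j))) j) + (\<Sum>m<N - j. A (j + m) j)" for j
        by (rule suminf_split_initial_segment[OF sm])
      thus ?thesis
        unfolding swap sum_subtractf[symmetric] by (simp only: distrib_right) simp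
    qed
    also have "norm \<dots> \<le> (\<Sum>j<N. C * g j * r ^ N / (1 - r) * norm (u j))"
    proof (rule sum_norm_le)
      fix j assume "j \<in> {..<N}"
      hence "j < N" by simp
      show "norm (- (\<Sum>m. A (j + (m + (N - j))) j) * u j) \<le> C * g j * r ^ N / (1 - r) * norm (u j)"
        unfolding norm_mult norm_minus_cancel
        by (rule mult_right_mono[OF tail[OF \<open>j < N\<close>] norm_ge_zero])
    qed
    also have "\<dots> = (\<Sum>j<N. C / (1 - r) * (g j * norm (u j) * r ^ j * r ^ (N - j)))"
      by (rule sum.cong) (auto simp: power_add[symmetric])
    finally show "norm ((\<Sum>n<N. \<Sum>j\<le>n. A n j * u j) - (\<Sum>j<N. (\<Sum>m. A (j + m) j) * u j)) \<le>
      C / (1 - r) * (\<Sum>j<N. g j * norm (u j) * r ^ j * r ^ (N - j))"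
      by (simp add: sum_distrib_left)
  qed
  show "(\<lambda>N. C / (1 - r) * (\<Sum>j<N. g j * norm (u j) * r ^ j * r ^ (N - j))) \<longlonglongrightarrow> 0"
    by (rule tendsto_mult_right_zero[OF convolution_geometric_tendsto_0[OF u r]])
qed

subsection \<open>Evaluation of \<open>F\<close>\<close>

lemma inverse_qpoch:
  assumes "norm q < 1" "qpoch_inf x q \<noteq> 0"
  shows "inverse (qpoch x q n) = qpoch_inf (x * q ^ n) q / qpoch_inf x q"
  using qpoch_inf_split[OF assms(1), of x n] qpoch_nonzero_if_qpoch_inf[OF assms, of n] assms(2)
  by (simp add: field_simps)

lemma norm_inverse_qpoch_le:
  assumes "norm q < 1" "qpoch_inf x q \<noteq> 0"
  shows "norm (inverse (qpoch x q n)) \<le> exp (norm x / (1 - norm q)) / norm (qpoch_inf x q)"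
  unfolding inverse_qpoch[OF assms] norm_divide
  by (intro divide_right_mono norm_qpoch_inf_le' norm_mult_power_le assms) auto

lemma tendsto_even_odd:
  fixes f :: "nat \<Rightarrow> 'a :: topological_space"
  assumes "(\<lambda>n. f (2 * n)) \<longlonglongrightarrow> l" "(\<lambda>n. f (2 * n + 1)) \<longlonglongrightarrow> l"
  shows "f \<longlonglongrightarrow> l"
proof (rule topological_tendstoI)
  fix S assume S: "open S" "l \<in> S"
  obtain M where M: "\<And>n. n \<ge> M \<Longrightarrow> f (2 * n) \<in> S"
    using topological_tendstoD[OF assms(1) S] by (auto simp: eventually_sequentially)
  obtain N where N: "\<And>n. n \<ge> N \<Longrightarrow> f (2 * n + 1) \<in> S"
    using topological_tendstoD[OF assms(2) S] by (auto simp: eventually_sequentially)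
  have "f n \<in> S" if "n \<ge> 2 * (M + N) + 1" for n
  proof (cases "even n")
    case True
    then obtain m where "n = 2 * m" by (elim evenE)
    thus ?thesis using that M[of m] by simp
  next
    case False
    then obtain m where "n = 2 * m + 1" by (elim oddE)
    thus ?thesis using that N[of m] by simp
  qed
  thus "eventually (\<lambda>n. f n \<in> S) sequentially"
    by (auto simp: eventually_sequentially)
qed

text \<open>One parameter point; the final theorem instantiates it at \<open>(a,k)\<close> and at
  \<open>(1/a,1/k)\<close>. Accordingly only \<open>norm q < norm (k / a)\<close> is assumed, the
  other bound being the same condition at the inverted point.\<close>

locale wp_parameters =
  fixes a k q :: complex
  assumes a: "a \<noteq> 0" and k: "k \<noteq> 0" and q0: "q \<noteq> 0" and q: "norm q < 1"
    and qak: "norm q < norm (k / a)"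
    and k1: "1 - k \<noteq> 0"
    and nz_aq: "qpoch_inf (a * q) q \<noteq> 0"
    and nz_kq: "qpoch_inf (k * q) q \<noteq> 0"
    and nz_kka: "qpoch_inf (k\<^sup>2 * q / a) (q\<^sup>2) \<noteq> 0"
begin

abbreviation p :: complex where "p \<equiv> q\<^sup>2"

abbreviation \<tau> :: complex where "\<tau> \<equiv> q * a / k"

lemma p: "norm p < 1"
  by (rule power2_norm_less_1[OF q])

lemma \<tau>: "norm \<tau> < 1" "norm (- q * a / k) < 1"
  using qak a k by (simp_all add: norm_mult norm_divide field_simps)

lemma nz_q: "qpoch_inf q q \<noteq> 0" "qpoch_inf q p \<noteq> 0" "qpoch_inf p p \<noteq> 0"
  using qpoch_inf_self_nonzero[OF q] qpoch_inf_double[OF q, of q]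
  by (auto simp: power2_eq_square)

lemma nz_\<tau>: "qpoch_inf \<tau> q \<noteq> 0" "qpoch_inf (- q * a / k) q \<noteq> 0" "qpoch_inf (p * a\<^sup>2 / k\<^sup>2) p \<noteq> 0"
  "qpoch_inf (q ^ 3 * a\<^sup>2 / k\<^sup>2) p \<noteq> 0"
proof -
  show "qpoch_inf \<tau> q \<noteq> 0" "qpoch_inf (- q * a / k) q \<noteq> 0"
    by (intro qpoch_inf_nonzero_norm q \<tau>)+
  have "norm (\<tau>\<^sup>2) < 1" by (rule power2_norm_less_1[OF \<tau>(1)])
  moreover have \<tau>2: "\<tau>\<^sup>2 = p * a\<^sup>2 / k\<^sup>2" by (simp add: power_divide power_mult_distrib)
  ultimately show "qpoch_inf (p * a\<^sup>2 / k\<^sup>2) p \<noteq> 0"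
    by (intro qpoch_inf_nonzero_norm p) simp
  have "norm (\<tau>\<^sup>2 * q) < 1"
    using \<open>norm (\<tau>\<^sup>2) < 1\<close> q norm_mult_power_le[OF q order_refl, of "\<tau>\<^sup>2" 1] by simp
  moreover have "\<tau>\<^sup>2 * q = q ^ 3 * a\<^sup>2 / k\<^sup>2"
    by (simp add: \<tau>2 power2_eq_square power3_eq_cube)
  ultimately show "qpoch_inf (q ^ 3 * a\<^sup>2 / k\<^sup>2) p \<noteq> 0"
    by (intro qpoch_inf_nonzero_norm p) simp
qed

lemma aq_split: "qpoch_inf (a * q) q = qpoch_inf (q * a) p * qpoch_inf (p * a) p"
  using qpoch_inf_double[OF q, of "a * q"] by (simp add: power2_eq_square mult_ac)

lemma nz_qa: "qpoch_inf (q * a) p \<noteq> 0" "qpoch_inf (p * a) p \<noteq> 0" "qpoch_inf (q ^ 3 * a) p \<noteq> 0"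
proof -
  show 1: "qpoch_inf (q * a) p \<noteq> 0" "qpoch_inf (p * a) p \<noteq> 0"
    using nz_aq by (auto simp: aq_split)
  show "qpoch_inf (q ^ 3 * a) p \<noteq> 0"
    using 1(1) qpoch_inf_Suc[OF p, of "q * a"] by (auto simp: power2_eq_square power3_eq_cube mult_ac)
qed

text \<open>
  \<open>coeff n j / scale\<close> is the coefficient of \<open>\<alpha>\<^sub>j\<close> in the \<open>n\<close>-th term of the \<open>\<beta>\<close>-series, with each
  \<open>1 / (z;q)\<^sub>n\<close> written as \<open>(z q\<^sup>n;q)\<^sub>\<infinity> / (z;q)\<^sub>\<infinity>\<close>.
\<close>

definition coeff :: "nat \<Rightarrow> nat \<Rightarrow> complex" where
  "coeff n j = (1 - k * q ^ (2 * n)) * qpoch q q (n - 1) * qpoch (k\<^sup>2 / a) q n * qpoch (q * a) p n *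
     (- q * a / k) ^ n * qpoch (k / a) q (n - j) * qpoch k q (n + j) *
     qpoch_inf (\<tau> * q ^ n) q * qpoch_inf (k * q * q ^ n) q * qpoch_inf (k\<^sup>2 * q / a * p ^ n) p *
     qpoch_inf (q * q ^ (n - j)) q * qpoch_inf (a * q * q ^ (n + j)) q"

definition scale :: complex where
  "scale = (1 - k) * qpoch_inf \<tau> q * qpoch_inf (k * q) q * qpoch_inf (k\<^sup>2 * q / a) p *
     qpoch_inf q q * qpoch_inf (a * q) q"

lemma scale_nonzero: "scale \<noteq> 0"
  using k1 nz_\<tau> nz_kq nz_kka nz_q nz_aq by (simp add: scale_def)

lemma F_term\<beta>_eq:
  assumes "WP_Bailey_pair_at \<alpha> \<beta> a k q" "n > 0"
  shows "F_term\<beta> \<beta> a k q n = (\<Sum>j\<le>n. coeff n j / scale * \<alpha> j a k q)"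
proof -
  have "\<beta> n a k q = (\<Sum>j\<le>n. (qpoch (k / a) q (n - j) * qpoch k q (n + j)) /
                   (qpoch q q (n - j) * qpoch (a * q) q (n + j)) * \<alpha> j a k q)"
    using assms by (simp add: WP_Bailey_pair_at_def atLeast0AtMost)
  moreover have "((1 - k * q ^ (2 * n)) * qpoch q q (n - 1) * qpoch (k\<^sup>2 / a) q n * qpoch (q * a) (q\<^sup>2) n) /
     ((1 - k) * qpochs [q * a / k, k * q] q n * qpoch (k\<^sup>2 * q / a) (q\<^sup>2) n) *
     (- q * a / k) ^ n * ((qpoch (k / a) q (n - j) * qpoch k q (n + j)) /
                   (qpoch q q (n - j) * qpoch (a * q) q (n + j))) = coeff n j / scale" for j
    unfolding coeff_def scale_def qpochs_def divide_inverse inverse_mult_distrib list.map prod_list.Cons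
      prod_list.Nil mult_1_right
      inverse_qpoch[OF q nz_\<tau>(1), unfolded divide_inverse] inverse_qpoch[OF q nz_kq]
      inverse_qpoch[OF p nz_kka, unfolded divide_inverse]
      inverse_qpoch[OF q nz_q(1)] inverse_qpoch[OF q nz_aq]
    by (simp only: mult_ac)
  ultimately show ?thesis
    unfolding F_term\<beta>_def by (simp only: sum_distrib_left mult.assoc[symmetric])
qed

text \<open>The factor \<open>qpoch (k\<^sup>2 / a) q j\<close> must not be estimated away: it may
  vanish for large \<open>j\<close>, and the convergence hypotheses control \<alpha> only in product
  with it.\<close>

lemma coeff_bound:
  obtains C where "0 \<le> C"
    "\<And>n j. j \<le> n \<Longrightarrow> norm (coeff n j) \<le> C * norm (qpoch (k\<^sup>2 / a) q j) * norm \<tau> ^ n"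
proof -
  define M where "M = norm k + norm q + norm (k\<^sup>2 / a) + norm (q * a) + norm (k / a) + norm \<tau> +
      norm (k * q) + norm (k\<^sup>2 * q / a) + norm (a * q)"
  define E where "E = exp (M / (1 - norm q))"
  define E2 where "E2 = exp (M / (1 - norm p))"
  have M: "norm k \<le> M" "norm q \<le> M" "norm (k\<^sup>2 / a) \<le> M" "norm (q * a) \<le> M" "norm (k / a) \<le> M" "norm \<tau> \<le> M"
      "norm (k * q) \<le> M" "norm (k\<^sup>2 * q / a) \<le> M" "norm (a * q) \<le> M"
    unfolding M_def by (simp_all add: add_nonneg_nonneg add_increasing add_increasing2)
  have M0: "0 \<le> M" using M(1) norm_ge_zero order_trans by blast
  have E0: "0 \<le> E" "0 \<le> E2" by (simp_all add: E_def E2_def)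
  define C where "C = (1 + M) * E * E * E2 * E * E * E * E * E2 * E * E"
  have "norm (coeff n j) \<le> C * norm (qpoch (k\<^sup>2 / a) q j) * norm \<tau> ^ n" if j: "j \<le> n" for n j
  proof -
    have split: "qpoch (k\<^sup>2 / a) q n = qpoch (k\<^sup>2 / a) q j * qpoch (k\<^sup>2 / a * q ^ j) q (n - j)"
      using qpoch_add[of "k\<^sup>2 / a" q j "n - j"] j by simp
    have b0: "norm (1 - k * q ^ (2 * n)) \<le> 1 + M"
      using norm_triangle_ineq4[of 1 "k * q ^ (2 * n)"] norm_mult_power_le[OF q M(1), of "2 * n"] by simp
    have b1: "norm (qpoch q q (n - 1)) \<le> E" "norm (qpoch (k\<^sup>2 / a * q ^ j) q (n - j)) \<le> E"
      "norm (qpoch (k / a) q (n - j)) \<le> E" "norm (qpoch k q (n + j)) \<le> E"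
      unfolding E_def by (intro norm_qpoch_le' norm_mult_power_le q M)+
    have b2: "norm (qpoch (q * a) p n) \<le> E2" "norm (qpoch_inf (k\<^sup>2 * q / a * p ^ n) p) \<le> E2"
      unfolding E2_def by (intro norm_qpoch_le' norm_qpoch_inf_le' norm_mult_power_le p M)+
    have b3: "norm (qpoch_inf (\<tau> * q ^ n) q) \<le> E" "norm (qpoch_inf (k * q * q ^ n) q) \<le> E"
      "norm (qpoch_inf (q * q ^ (n - j)) q) \<le> E" "norm (qpoch_inf (a * q * q ^ (n + j)) q) \<le> E"
      unfolding E_def by (intro norm_qpoch_inf_le' norm_mult_power_le q M)+
    have z: "norm ((- q * a / k) ^ n) = norm \<tau> ^ n"
      by (simp add: norm_power norm_mult norm_divide)
    have "norm (coeff n j) \<le> (1 + M) * E * (norm (qpoch (k\<^sup>2 / a) q j) * E) * E2 * norm \<tau> ^ n *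
        E * E * E * E * E2 * E * E"
      unfolding coeff_def split norm_mult z
      by (intro mult_mono b0 b1 b2 b3 mult_nonneg_nonneg order_refl) (use M0 E0 in simp_all)
    thus ?thesis by (simp only: C_def mult_ac)
  qed
  moreover have "0 \<le> C" using M0 E0 by (simp add: C_def)
  ultimately show ?thesis by (intro that)
qed

text \<open>The Watson parameters are \<open>b = k / a\<close>, \<open>x = 1\<close>,
  \<open>y = k^2 / a\<close>. The term m = 0 is excluded by hand: truncated subtraction makes
  \<open>coeff 0 0 / scale\<close> equal to 1, whereas the \<beta>-series starts at n = 1.\<close>

lemma suminf_coeff_0:
  "(\<Sum>m. (if m = 0 then 0 else coeff m 0 / scale)) =
     qlambert (k * q) q + qlambert q p + qlambert (p * a\<^sup>2 / k\<^sup>2) p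
     - qlambert (p * a) p - qlambert \<tau> q - qlambert (k\<^sup>2 * q / a) p"
proof -
  define b where "b = k / a"
  define y where "y = k\<^sup>2 / a"
  have qb: "norm q < norm b" using qak by (simp add: b_def)
  have e': "y * q = k\<^sup>2 * q / a" by (simp add: y_def)
  have e: "y / b = k" "y * q / b\<^sup>2 = a * q" "p / b\<^sup>2 = p * a\<^sup>2 / k\<^sup>2" "q / b = \<tau>"
    "y * p / b\<^sup>2 = p * a" "- q / b = - q * a / k" "y * q / b = k * q" "y / b\<^sup>2 = a"
    using a k by (simp_all add: b_def y_def power2_eq_square field_simps)
  have nz: "qpoch_inf (y / b) q \<noteq> 0" "qpoch_inf (y * q / b\<^sup>2) q \<noteq> 0" "qpoch_inf (y * q) p \<noteq> 0"
    unfolding e unfolding e' using k1 nz_kq qpoch_inf_Suc[OF q, of k] nz_aq nz_kka by auto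
  have core: "watson_core q b 1 y 0 = scale"
    unfolding watson_core_def scale_def mult_1 e unfolding e' by (simp add: mult_ac)
  have pp: "q ^ (2 * n) = p ^ n" for n by (simp add: power_mult)
  have "coeff (Suc m) 0 = qpoch q q m * watson_core q b 1 y (Suc m)" for m
    unfolding coeff_def watson_core_def mult_1 pp e unfolding e'
    by (simp add: b_def y_def mult_ac)
  hence *: "coeff (Suc m) 0 / scale = (qpoch q q m * watson_core q b 1 y (Suc m)) / scale" for m by simp
  have sm: "summable (\<lambda>m. qpoch q q m * watson_core q b 1 y (m + 1))"
    by (rule tendsto_suminf_watson(2)[OF q qb, of sequentially "\<lambda>_. 1" 1 "\<lambda>_. y" y "\<lambda>_. q"]) auto
  have "(\<Sum>m. (if m = 0 then 0 else coeff m 0 / scale)) = (\<Sum>m. coeff (Suc m) 0 / scale)"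
  proof -
    have "summable (\<lambda>m. coeff (Suc m) 0 / scale)"
      unfolding * using sm by (intro summable_divide) simp
    hence "summable (\<lambda>m. (if Suc m = 0 then 0 else coeff (Suc m) 0 / scale))" by simp
    hence "summable (\<lambda>m. (if m = 0 then 0 else coeff m 0 / scale))"
      by (subst (asm) summable_Suc_iff)
    from suminf_split_head[OF this] show ?thesis by simp
  qed
  also have "\<dots> = (\<Sum>m. qpoch q q m * watson_core q b 1 y (Suc m)) / scale"
    unfolding * using sm by (intro suminf_divide) simp
  also have "\<dots> = qlambert (y / b * q) q + qlambert q p + qlambert (p / b\<^sup>2) p
       - qlambert (y * p / b\<^sup>2) p - qlambert (q / b) q - qlambert (y * q) p"
    unfolding suminf_watson_core_at_1[OF q qb nz] core using scale_nonzero by simp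
  finally show ?thesis unfolding e unfolding e' .
qed

text \<open>The shift n = j + m turns the column into a Watson series with \<open>x = q^j\<close>
  and \<open>y = (k^2/a) q^j\<close>. All infinite products are in base \<open>q^2\<close> with a
  factor \<open>q^j\<close>, so the parity of \<open>j\<close> decides what they simplify
  to.\<close>

lemma suminf_coeff:
  assumes j: "j > 0"
  shows "(\<Sum>m. coeff (j + m) j / scale) =
    qpoch q q (j - 1) * qpoch (k\<^sup>2 / a) q j * (- q * a / k) ^ j *
    (qpoch_inf (q * q ^ j) p * qpoch_inf (k\<^sup>2 / a * q * q ^ j) p *
     qpoch_inf (p * a\<^sup>2 / k\<^sup>2 * q ^ j) p * qpoch_inf (p * a * q ^ j) p) /
    (qpoch_inf (p * a\<^sup>2 / k\<^sup>2) p * qpoch_inf (k\<^sup>2 * q / a) p * qpoch_inf (p * a) p * qpoch_inf q p)"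
proof -
  define b where "b = k / a"
  define x where "x = q ^ j"
  define y where "y = k\<^sup>2 / a * q ^ j"
  define K where "K = qpoch q q (j - 1) * qpoch (k\<^sup>2 / a) q j * qpoch (q * a) p j * qpoch k q (2 * j) * (- q * a / k) ^ j"
  have qb: "norm q < norm b" using qak by (simp add: b_def)
  have pp: "q ^ (2 * n) = p ^ n" for n by (simp add: power_mult)
  have pj: "q ^ j * q ^ j = p ^ j" by (simp add: power2_eq_square power_mult_distrib)
  have e: "x * y / b = k * p ^ j" "x * y * q / b\<^sup>2 = q * a * p ^ j" "x * q / b = \<tau> * q ^ j"
      "y * q / b = k * q * q ^ j" "- q / b = - q * a / k" 
      "x * q\<^sup>2 / b\<^sup>2 = p * a\<^sup>2 / k\<^sup>2 * q ^ j" "y * q\<^sup>2 / b\<^sup>2 = p * a * q ^ j"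
    unfolding pj[symmetric] using a k by (simp_all add: x_def y_def b_def power2_eq_square field_simps)
  have e': "x * y * q = k\<^sup>2 * q / a * p ^ j" "x * q = q * q ^ j" "y * q = k\<^sup>2 / a * q * q ^ j"
    unfolding pj[symmetric] by (simp_all add: x_def y_def)
  have coeff: "coeff (j + m) j = K * watson_term q b x y m" for m
  proof -
    \<comment> \<open>Here \<open>j > 0\<close> enters: the subtraction is genuine, and the split
      produces the factor \<open>(x;q)_m\<close> at \<open>x = q^j\<close>.\<close>
    have 1: "qpoch q q (j + m - 1) = qpoch q q (j - 1) * qpoch (q ^ j) q m"
    proof -
      have "q * q ^ (j - 1) = q ^ j" using j by (simp add: power_Suc[symmetric] del: power_Suc)
      thus ?thesis using qpoch_add[of q q "j - 1" m] j by simp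
    qed
    have 2: "qpoch k q (j + m + j) = qpoch k q (2 * j) * qpoch (k * p ^ j) q m"
    proof -
      have "j + m + j = 2 * j + m" by simp
      thus ?thesis using qpoch_add[of k q "2 * j" m] by (simp only: pp)
    qed
    have 3: "q ^ (j + m + j) = p ^ j * q ^ m"
      by (simp add: pj[symmetric] power_add mult_ac)
    show ?thesis
      unfolding coeff_def watson_term_def watson_core_def pp e unfolding e' 
      unfolding 1 2 3 unfolding qpoch_add[of "k\<^sup>2 / a"] qpoch_add[of "q * a"] power_add add_diff_cancel_left' K_def
      unfolding x_def y_def b_def
      by (simp only: mult_ac)
  qed
  have sm: "summable (watson_term q b x y)"
    by (rule summable_watson_term[OF q qb])
  have "(\<Sum>m. coeff (j + m) j / scale) = K / scale * (\<Sum>m. watson_term q b x y m)"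
    unfolding coeff using sm suminf_mult[OF sm, of "K / scale"] by simp
  also have "(\<Sum>m. watson_term q b x y m) = qpoch_inf (k * p ^ j) q * qpoch_inf (q * a * p ^ j) p *
     qpoch_inf (q * q ^ j) p * qpoch_inf (k\<^sup>2 / a * q * q ^ j) p *
     qpoch_inf (p * a\<^sup>2 / k\<^sup>2 * q ^ j) p * qpoch_inf (p * a * q ^ j) p * qpoch_inf p p / qpoch_inf (- q * a / k) q"
    using suminf_watson_term[OF q qb, of x y, unfolded e, unfolded e'] nz_\<tau>(2) by (simp add: field_simps)
  finally have main: "(\<Sum>m. coeff (j + m) j / scale) = K / scale * (qpoch_inf (k * p ^ j) q * qpoch_inf (q * a * p ^ j) p *
     qpoch_inf (q * q ^ j) p * qpoch_inf (k\<^sup>2 / a * q * q ^ j) p *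
     qpoch_inf (p * a\<^sup>2 / k\<^sup>2 * q ^ j) p * qpoch_inf (p * a * q ^ j) p * qpoch_inf p p / qpoch_inf (- q * a / k) q)" .
  define Z where "Z = (1 - k) * qpoch_inf (k * q) q * qpoch_inf (q * a) p * qpoch_inf p p"
  have Z: "Z \<noteq> 0"
    using k1 nz_kq nz_qa nz_q by (simp add: Z_def)
  define N where "N = qpoch q q (j - 1) * qpoch (k\<^sup>2 / a) q j * (- q * a / k) ^ j *
    (qpoch_inf (q * q ^ j) p * qpoch_inf (k\<^sup>2 / a * q * q ^ j) p *
     qpoch_inf (p * a\<^sup>2 / k\<^sup>2 * q ^ j) p * qpoch_inf (p * a * q ^ j) p)"
  define D where "D = qpoch_inf (p * a\<^sup>2 / k\<^sup>2) p * qpoch_inf (k\<^sup>2 * q / a) p * qpoch_inf (p * a) p * qpoch_inf q p"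
  have num: "K * (qpoch_inf (k * p ^ j) q * qpoch_inf (q * a * p ^ j) p *
     qpoch_inf (q * q ^ j) p * qpoch_inf (k\<^sup>2 / a * q * q ^ j) p *
     qpoch_inf (p * a\<^sup>2 / k\<^sup>2 * q ^ j) p * qpoch_inf (p * a * q ^ j) p * qpoch_inf p p) = Z * N"
  proof -
    have 1: "(1 - k) * qpoch_inf (k * q) q = qpoch k q (2 * j) * qpoch_inf (k * p ^ j) q"
      using qpoch_inf_Suc[OF q, of k] qpoch_inf_split[OF q, of k "2 * j"] by (simp add: pp)
    have 2: "qpoch_inf (q * a) p = qpoch (q * a) p j * qpoch_inf (q * a * p ^ j) p"
      by (rule qpoch_inf_split[OF p])
    show ?thesis
      unfolding Z_def N_def K_def 1 2 by (simp only: mult_ac)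
  qed
  have den: "scale * qpoch_inf (- q * a / k) q = Z * D"
  proof -
    have 1: "qpoch_inf (p * a\<^sup>2 / k\<^sup>2) p = qpoch_inf \<tau> q * qpoch_inf (- q * a / k) q"
      using qpoch_inf_square[OF q, of \<tau>] by (simp add: power_divide power_mult_distrib)
    have 2: "qpoch_inf q q = qpoch_inf q p * qpoch_inf p p"
      using qpoch_inf_double[OF q, of q] by (simp add: power2_eq_square)
    show ?thesis
      unfolding scale_def Z_def D_def 1 2 aq_split by (simp only: mult_ac)
  qed
  have "(\<Sum>m. coeff (j + m) j / scale) = (Z * N) / (Z * D)"
    unfolding main num[symmetric] den[symmetric] by simp
  also have "\<dots> = N / D" using Z by simp
  finally show ?thesis unfolding N_def D_def .
qed

text \<open>For even index the four infinite products are tails of exactly those in the denominator,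
  so only finite factorials survive.\<close>

lemma suminf_coeff_even:
  assumes n: "n > 0"
  shows "(\<Sum>m. coeff (2 * n + m) (2 * n) / scale) * \<alpha> (2 * n) a k q = F_term_even \<alpha> a k q n"
proof -
  have pp: "q ^ (2 * n) = p ^ n" by (simp add: power_mult)
  have qn0: "qpoch p p n \<noteq> 0" "qpoch q p n \<noteq> 0"
    by (intro qpoch_nonzero_if_qpoch_inf p nz_q)+
  obtain n' where n': "n = Suc n'" using n by (cases n) auto
  have "qpoch q q (2 * n - 1) * (1 - p ^ n) = qpoch q p n * qpoch p p (n - 1) * (1 - p ^ n)"
    using qpoch_double[of q q n] qpoch_Suc[of q q "2 * n - 1"] qpoch_Suc[of p p n']
    by (auto simp: n' power_mult power2_eq_square power_mult_distrib mult_ac)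
  moreover have "1 - p ^ n \<noteq> 0"
    using qn0(1) qpoch_Suc[of p p n'] by (auto simp: n')
  ultimately have 1: "qpoch q q (2 * n - 1) = qpoch q p n * qpoch p p (n - 1)" by simp
  have 2: "qpoch (k\<^sup>2 / a) q (2 * n) = qpoch (k\<^sup>2 / a) p n * qpoch (k\<^sup>2 * q / a) p n"
    using qpoch_double[of "k\<^sup>2 / a" q n] by simp
  have 3: "(- q * a / k) ^ (2 * n) = \<tau> ^ (2 * n)" by simp
  define P1 where "P1 = qpoch_inf (q * p ^ n) p"
  define P2 where "P2 = qpoch_inf (k\<^sup>2 * q / a * p ^ n) p"
  define P3 where "P3 = qpoch_inf (p * a\<^sup>2 / k\<^sup>2 * p ^ n) p"
  define P4 where "P4 = qpoch_inf (p * a * p ^ n) p"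
  have s: "qpoch_inf q p = qpoch q p n * P1" "qpoch_inf (k\<^sup>2 * q / a) p = qpoch (k\<^sup>2 * q / a) p n * P2"
    "qpoch_inf (p * a\<^sup>2 / k\<^sup>2) p = qpoch (p * a\<^sup>2 / k\<^sup>2) p n * P3"
    "qpoch_inf (p * a) p = qpoch (p * a) p n * P4"
    unfolding P1_def P2_def P3_def P4_def by (rule qpoch_inf_split[OF p])+
  have nz: "P1 \<noteq> 0" "P2 \<noteq> 0" "P3 \<noteq> 0" "P4 \<noteq> 0" "qpoch (k\<^sup>2 * q / a) p n \<noteq> 0"
    using nz_q(2) nz_kka nz_\<tau>(3) nz_qa(2) unfolding s by auto
  have "(\<Sum>m. coeff (2 * n + m) (2 * n) / scale) =
    (qpoch q p n * qpoch p p (n - 1)) * (qpoch (k\<^sup>2 / a) p n * qpoch (k\<^sup>2 * q / a) p n) * \<tau> ^ (2 * n) *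
    (P1 * P2 * P3 * P4) / ((qpoch (p * a\<^sup>2 / k\<^sup>2) p n * P3) * (qpoch (k\<^sup>2 * q / a) p n * P2) *
      (qpoch (p * a) p n * P4) * (qpoch q p n * P1))"
    unfolding s[symmetric] using n suminf_coeff[of "2 * n", unfolded 1 2 3, unfolded pp]
    by (simp add: P1_def P2_def P3_def P4_def mult_ac pp)
  also have "\<dots> = qpoch p p (n - 1) * qpoch (k\<^sup>2 / a) p n / (qpoch (p * a\<^sup>2 / k\<^sup>2) p n * qpoch (p * a) p n) * \<tau> ^ (2 * n)"
    using nz qn0 by simp
  finally show ?thesis
    unfolding F_term_even_def qpochs_def by simp
qed

text \<open>For odd index the products are tails of the four numerators in the prefactor of the odd
  series in \<open>F\<close>, so nothing infinite cancels; the sign is that of an odd power of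
  \<open>- \<tau>\<close>.\<close>

lemma suminf_coeff_odd:
  "(\<Sum>m. coeff (2 * n + 1 + m) (2 * n + 1) / scale) * \<alpha> (2 * n + 1) a k q =
     - (qpochs_inf [k\<^sup>2 / a, q ^ 3 * a\<^sup>2 / k\<^sup>2, q ^ 3 * a, q\<^sup>2] (q\<^sup>2) /
       qpochs_inf [k\<^sup>2 * q / a, q\<^sup>2 * a\<^sup>2 / k\<^sup>2, q\<^sup>2 * a, q] (q\<^sup>2) * F_term_odd \<alpha> a k q n)"
proof -
  have pp: "q ^ (2 * n + 1) = q * p ^ n" by (simp add: power_mult)
  have 1: "qpoch q q (2 * n + 1 - 1) = qpoch q p n * qpoch p p n"
    using qpoch_double[of q q n] by (simp add: power2_eq_square)
  have 2: "qpoch (k\<^sup>2 / a) q (2 * n + 1) = qpoch (k\<^sup>2 / a) p (Suc n) * qpoch (k\<^sup>2 * q / a) p n"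
  proof -
    have "qpoch (k\<^sup>2 / a) q (2 * n + 1) = qpoch (k\<^sup>2 / a) q (2 * n) * (1 - k\<^sup>2 / a * p ^ n)"
      using qpoch_Suc[of "k\<^sup>2 / a" q "2 * n"] by (simp add: power_mult)
    thus ?thesis
      unfolding qpoch_double qpoch_Suc by (simp add: mult_ac)
  qed
  have 3: "(- q * a / k) ^ (2 * n + 1) = - (\<tau> ^ (2 * n + 1))"
    by simp
  define P1 where "P1 = qpoch_inf (p * p ^ n) p"
  define P2 where "P2 = qpoch_inf (k\<^sup>2 / a * p ^ Suc n) p"
  define P3 where "P3 = qpoch_inf (q ^ 3 * a\<^sup>2 / k\<^sup>2 * p ^ n) p"
  define P4 where "P4 = qpoch_inf (q ^ 3 * a * p ^ n) p"
  have s: "qpoch_inf p p = qpoch p p n * P1" "qpoch_inf (k\<^sup>2 / a) p = qpoch (k\<^sup>2 / a) p (Suc n) * P2"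
    "qpoch_inf (q ^ 3 * a\<^sup>2 / k\<^sup>2) p = qpoch (q ^ 3 * a\<^sup>2 / k\<^sup>2) p n * P3"
    "qpoch_inf (q ^ 3 * a) p = qpoch (q ^ 3 * a) p n * P4"
    unfolding P1_def P2_def P3_def P4_def by (rule qpoch_inf_split[OF p])+
  have nz: "qpoch (q ^ 3 * a\<^sup>2 / k\<^sup>2) p n \<noteq> 0" "qpoch (q ^ 3 * a) p n \<noteq> 0"
    using nz_\<tau>(4) nz_qa(3) unfolding s by auto
  define D where "D = qpoch_inf (k\<^sup>2 * q / a) p * qpoch_inf (p * a\<^sup>2 / k\<^sup>2) p * qpoch_inf (p * a) p * qpoch_inf q p"
  have e: "q * (q * p ^ n) = p * p ^ n" "k\<^sup>2 / a * q * (q * p ^ n) = k\<^sup>2 / a * p ^ Suc n"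
    "p * a\<^sup>2 / k\<^sup>2 * (q * p ^ n) = q ^ 3 * a\<^sup>2 / k\<^sup>2 * p ^ n" "p * a * (q * p ^ n) = q ^ 3 * a * p ^ n"
    by (simp_all add: power2_eq_square power3_eq_cube)
  have "(\<Sum>m. coeff (2 * n + 1 + m) (2 * n + 1) / scale) = 
     - (qpoch q p n * qpoch p p n * (qpoch (k\<^sup>2 / a) p (Suc n) * qpoch (k\<^sup>2 * q / a) p n) * \<tau> ^ (2 * n + 1) *
       (P1 * P2 * P3 * P4) / D)"
    using suminf_coeff[of "2 * n + 1", unfolded 1 2 3, unfolded pp e]
    unfolding P1_def P2_def P3_def P4_def D_def by (simp only: mult_ac) simp
  also have "\<dots> = - ((qpoch (k\<^sup>2 / a) p (Suc n) * P2) * (qpoch (q ^ 3 * a\<^sup>2 / k\<^sup>2) p n * P3) *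
      (qpoch (q ^ 3 * a) p n * P4) * (qpoch p p n * P1) / D *
      (qpoch (k\<^sup>2 * q / a) p n * qpoch q p n / (qpoch (q ^ 3 * a\<^sup>2 / k\<^sup>2) p n * qpoch (q ^ 3 * a) p n) * \<tau> ^ (2 * n + 1)))"
    using nz by simp (simp only: mult_ac)
  finally show ?thesis
    unfolding s[symmetric] F_term_odd_def qpochs_def qpochs_inf_def D_def by (simp add: mult_ac)
qed

end

section \<open>Reduction of F to Lambert series\<close>

context wp_parameters
begin

text \<open>The terms of the even and odd \<alpha>-series tend to 0. They differ from the sequence
  considered here by factorials and inverse factorials, all bounded because the corresponding
  infinite products do not vanish.\<close>

lemma alpha_null:
  assumes conv: "F_series_converge \<alpha> \<beta> a k q"
  shows "(\<lambda>j. norm (qpoch (k\<^sup>2 / a) q j) * norm (\<alpha> j a k q) * norm \<tau> ^ j) \<longlonglongrightarrow> 0"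
proof -
  define f where "f = (\<lambda>j. qpoch (k\<^sup>2 / a) q j * \<alpha> j a k q * \<tau> ^ j)"
  have null: "h \<longlonglongrightarrow> 0" if "Bseq b" "t \<longlonglongrightarrow> 0" "\<And>n. h n = b n * t n" for h b t :: "nat \<Rightarrow> complex"
    using bounded_bilinear.Bfun_prod_Zfun[OF bounded_bilinear_mult that(1), of t] that(2,3)
    by (simp add: tendsto_Zfun_iff)
  have bseq: "Bseq (\<lambda>n. qpoch x p n)" for x
    by (rule BseqI'[of _ "exp (norm x / (1 - norm p))"]) (rule norm_qpoch_le[OF p])
  have bseq': "Bseq (\<lambda>n. qpoch x q n)" for x
    by (rule BseqI'[of _ "exp (norm x / (1 - norm q))"]) (rule norm_qpoch_le[OF q])
  have bseq_inv: "Bseq (\<lambda>n. inverse (qpoch x p n))" if "qpoch_inf x p \<noteq> 0" for x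
    by (rule BseqI'[OF norm_inverse_qpoch_le[OF p that]])
  have nz: "qpoch (p * a\<^sup>2 / k\<^sup>2) p n \<noteq> 0" "qpoch (p * a) p n \<noteq> 0" "qpoch p p n \<noteq> 0"
    "qpoch (q ^ 3 * a\<^sup>2 / k\<^sup>2) p n \<noteq> 0" "qpoch (q ^ 3 * a) p n \<noteq> 0"
    "qpoch (k\<^sup>2 * q / a) p n \<noteq> 0" "qpoch q p n \<noteq> 0" for n
    by (intro qpoch_nonzero_if_qpoch_inf p nz_\<tau> nz_qa nz_q nz_kka)+
  have "(\<lambda>n. f (2 * Suc n)) \<longlonglongrightarrow> 0"
  proof (rule null)
    show "(\<lambda>n. F_term_even \<alpha> a k q (n + 1)) \<longlonglongrightarrow> 0"
      using conv by (intro summable_LIMSEQ_zero) (simp add: F_series_converge_def)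
    show "Bseq (\<lambda>n. qpoch (k\<^sup>2 / a * q) p (Suc n) * qpoch (p * a\<^sup>2 / k\<^sup>2) p (Suc n) * qpoch (p * a) p (Suc n) *
        inverse (qpoch p p n))"
      by (intro Bseq_mult bseq_inv nz_q Bseq_Suc_iff[THEN iffD2] bseq)
    show "f (2 * Suc n) = qpoch (k\<^sup>2 / a * q) p (Suc n) * qpoch (p * a\<^sup>2 / k\<^sup>2) p (Suc n) * qpoch (p * a) p (Suc n) *
        inverse (qpoch p p n) * F_term_even \<alpha> a k q (n + 1)" for n
      unfolding f_def qpoch_double F_term_even_def qpochs_def using nz by (simp add: divide_simps)
  qed
  hence 1: "(\<lambda>n. f (2 * n)) \<longlonglongrightarrow> 0"
    using filterlim_sequentially_Suc[of "\<lambda>n. f (2 * n)"] by blast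
  have 2: "(\<lambda>n. f (2 * n + 1)) \<longlonglongrightarrow> 0"
  proof (rule null)
    show "F_term_odd \<alpha> a k q \<longlonglongrightarrow> 0"
      using conv by (intro summable_LIMSEQ_zero) (simp add: F_series_converge_def)
    have "Bseq (\<lambda>n. qpoch (k\<^sup>2 / a) q (2 * n + 1))"
      by (rule Bseq_subseq[OF bseq', unfolded o_def]) 
    thus "Bseq (\<lambda>n. qpoch (k\<^sup>2 / a) q (2 * n + 1) * qpoch (q ^ 3 * a\<^sup>2 / k\<^sup>2) p n * qpoch (q ^ 3 * a) p n *
        inverse (qpoch (k\<^sup>2 * q / a) p n) * inverse (qpoch q p n))"
      by (intro Bseq_mult bseq bseq_inv nz_kka nz_q)
    show "f (2 * n + 1) = qpoch (k\<^sup>2 / a) q (2 * n + 1) * qpoch (q ^ 3 * a\<^sup>2 / k\<^sup>2) p n * qpoch (q ^ 3 * a) p n *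
        inverse (qpoch (k\<^sup>2 * q / a) p n) * inverse (qpoch q p n) * F_term_odd \<alpha> a k q n" for n
      unfolding f_def F_term_odd_def qpochs_def using nz by (simp add: divide_simps)
  qed
  have "f \<longlonglongrightarrow> 0" using 1 2 by (rule tendsto_even_odd)
  from tendsto_norm_zero[OF this] show ?thesis
    by (simp add: f_def norm_mult norm_power)
qed

theorem F_eq_qlambert:
  assumes pair: "WP_Bailey_pair_at \<alpha> \<beta> a k q" and conv: "F_series_converge \<alpha> \<beta> a k q"
  shows "F \<alpha> \<beta> a k q =
     qlambert (k * q) q + qlambert q p + qlambert (p * a\<^sup>2 / k\<^sup>2) p
     - qlambert (p * a) p - qlambert \<tau> q - qlambert (k\<^sup>2 * q / a) p"
proof -
  define u where "u = (\<lambda>j. \<alpha> j a k q)"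
  define A where "A = (\<lambda>n j. if n = 0 then 0 else coeff n j / scale)"
  define S where "S = (\<lambda>j. \<Sum>m. A (j + m) j)"
  define c where "c = qpochs_inf [k\<^sup>2 / a, q ^ 3 * a\<^sup>2 / k\<^sup>2, q ^ 3 * a, q\<^sup>2] (q\<^sup>2) /
       qpochs_inf [k\<^sup>2 * q / a, q\<^sup>2 * a\<^sup>2 / k\<^sup>2, q\<^sup>2 * a, q] (q\<^sup>2)"
  define B where "B = (\<Sum>n. F_term\<beta> \<beta> a k q (n + 1))"
  define E where "E = (\<Sum>n. F_term_even \<alpha> a k q (n + 1))"
  define O' where "O' = (\<Sum>n. F_term_odd \<alpha> a k q n)"
  obtain C where C: "0 \<le> C"
    "\<And>n j. j \<le> n \<Longrightarrow> norm (coeff n j) \<le> C * norm (qpoch (k\<^sup>2 / a) q j) * norm \<tau> ^ n"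
    using coeff_bound by blast
  have "(\<lambda>N. (\<Sum>n<N. \<Sum>j\<le>n. A n j * u j) - (\<Sum>j<N. S j * u j)) \<longlonglongrightarrow> 0"
    unfolding S_def
  proof (rule triangular_sum_interchange)
    show "norm (A n j) \<le> C / norm scale * norm (qpoch (k\<^sup>2 / a) q j) * norm \<tau> ^ n" if "j \<le> n" for n j
      using C(1) divide_right_mono[OF C(2)[OF that], of "norm scale"] by (auto simp: A_def norm_divide)
    show "(\<lambda>j. norm (qpoch (k\<^sup>2 / a) q j) * norm (u j) * norm \<tau> ^ j) \<longlonglongrightarrow> 0"
      unfolding u_def by (rule alpha_null[OF conv])
  qed (use C(1) \<tau>(1) in auto)
  note diff = this
  have lim: "(\<lambda>N. \<Sum>n<N. \<Sum>j\<le>n. A n j * u j) \<longlonglongrightarrow> B"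
  proof -
    have "(\<lambda>n. F_term\<beta> \<beta> a k q (n + 1)) sums B"
      unfolding B_def using conv by (intro summable_sums) (simp add: F_series_converge_def)
    hence "(\<lambda>n. \<Sum>j\<le>Suc n. A (Suc n) j * u j) sums B"
      using F_term\<beta>_eq[OF pair, of "Suc n" for n] by (simp add: A_def u_def)
    from sums_Suc[OF this] show ?thesis
      by (simp add: sums_def A_def)
  qed
  from tendsto_diff[OF lim diff] have "(\<lambda>N. \<Sum>j<N. S j * u j) \<longlonglongrightarrow> B"
    by simp
  \<comment> \<open>Partial sums of even length suffice to identify the limit, and they pair each
    even index with the next odd one, matching the two \<alpha>-series.\<close>
  hence "(\<lambda>N. \<Sum>j<2 * N. S j * u j) \<longlonglongrightarrow> B"
    by (intro filterlim_compose[of "\<lambda>N. \<Sum>j<N. S j * u j" _ sequentially "\<lambda>N. 2 * N"])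
       (auto intro: filterlim_at_top_mono[OF filterlim_ident])
  moreover have "(\<Sum>j<2 * N. S j * u j) = (\<Sum>n<N. S (2 * n) * u (2 * n) + S (2 * n + 1) * u (2 * n + 1))" for N
    by (induction N) (simp_all add: algebra_simps)
  ultimately have "(\<lambda>n. S (2 * n) * u (2 * n) + S (2 * n + 1) * u (2 * n + 1)) sums B"
    by (simp add: sums_def)
  moreover have "(\<lambda>n. S (2 * n) * u (2 * n) + S (2 * n + 1) * u (2 * n + 1)) sums ((E + S 0) + - (c * O'))"
  proof (rule sums_add)
    have "(\<lambda>n. F_term_even \<alpha> a k q (Suc n)) sums E"
      unfolding E_def using conv summable_sums[of "\<lambda>n. F_term_even \<alpha> a k q (Suc n)"]
      by (simp add: F_series_converge_def)
    moreover have "F_term_even \<alpha> a k q (Suc n) = S (2 * Suc n) * u (2 * Suc n)" for n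
      using suminf_coeff_even[of "Suc n" \<alpha>] by (simp add: S_def A_def u_def)
    ultimately have "(\<lambda>n. S (2 * Suc n) * u (2 * Suc n)) sums E" by simp
    \<comment> \<open>The even series in \<open>F\<close> starts at 1; the index 0, with \<alpha>
      equal to 1 there, contributes the surviving \<open>S 0\<close>.\<close>
    from sums_Suc[OF this] show "(\<lambda>n. S (2 * n) * u (2 * n)) sums (E + S 0)"
      using pair by (simp add: u_def WP_Bailey_pair_at_def)
    have "F_term_odd \<alpha> a k q sums O'"
      unfolding O'_def using conv by (intro summable_sums) (simp add: F_series_converge_def)
    hence "(\<lambda>n. - (c * F_term_odd \<alpha> a k q n)) sums (- (c * O'))"
      by (intro sums_minus sums_mult)
    moreover have "- (c * F_term_odd \<alpha> a k q n) = S (2 * n + 1) * u (2 * n + 1)" for n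
      using suminf_coeff_odd[of n \<alpha>] by (simp add: S_def A_def u_def c_def)
    ultimately show "(\<lambda>n. S (2 * n + 1) * u (2 * n + 1)) sums (- (c * O'))" by simp
  qed
  ultimately have "B = (E + S 0) + - (c * O')"
    by (rule sums_unique2)
  hence "F \<alpha> \<beta> a k q = S 0"
    by (simp add: F_def B_def E_def O'_def c_def)
  thus ?thesis
    unfolding S_def A_def by (simp only: add_0 suminf_coeff_0)
qed

end

section \<open>The difference as an identity between theta functions\<close>

theorem theorem1:
  fixes a k q :: complex and \<alpha> \<beta> :: param_seq
  assumes "a \<noteq> 0" and "k \<noteq> 0" and "q \<noteq> 0"
    and "norm q < Min {1, norm (a / k), norm (k / a)}"
    and "WP_Bailey_pair_at \<alpha> \<beta> a k q"
    and "WP_Bailey_pair_at \<alpha> \<beta> (1 / a) (1 / k) q"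
    and "WP_Bailey_denoms_nonzero a q"
    and "WP_Bailey_denoms_nonzero (1 / a) q"
    and "F_denoms_nonzero a k q"
    and "F_denoms_nonzero (1 / a) (1 / k) q"
    and "qpochs_inf [a * q / k\<^sup>2, k\<^sup>2 * q / a, a, q\<^sup>2 / a, k\<^sup>2, q\<^sup>2 / k\<^sup>2, q, q] (q\<^sup>2) \<noteq> 0"
    and "qpochs_inf [k\<^sup>2, q\<^sup>2 / k\<^sup>2, a\<^sup>2 / k\<^sup>2, q\<^sup>2 * k\<^sup>2 / a\<^sup>2] (q\<^sup>2) \<noteq> 0"
    and "(1 - a) * (1 - k) * (a\<^sup>2 - k\<^sup>2) \<noteq> 0"
    and "F_series_converge \<alpha> \<beta> a k q"
    and "F_series_converge \<alpha> \<beta> (1 / a) (1 / k) q"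
  shows "F \<alpha> \<beta> a k q - F \<alpha> \<beta> (1 / a) (1 / k) q =
      a * q / k\<^sup>2 *
        (qpochs_inf [a * q, q / a, k\<^sup>2 / a, q\<^sup>2 * a / k\<^sup>2, k\<^sup>2 / q, q ^ 3 / k\<^sup>2, q\<^sup>2, q\<^sup>2] (q\<^sup>2) /
         qpochs_inf [a * q / k\<^sup>2, k\<^sup>2 * q / a, a, q\<^sup>2 / a, k\<^sup>2, q\<^sup>2 / k\<^sup>2, q, q] (q\<^sup>2))
      - a / k *
        (qpochs_inf [k\<^sup>2 / a, q * a / k\<^sup>2, - a, - q / a] q * qpochs_inf [q\<^sup>2, q\<^sup>2] (q\<^sup>2) /
         qpochs_inf [k\<^sup>2, q\<^sup>2 / k\<^sup>2, a\<^sup>2 / k\<^sup>2, q\<^sup>2 * k\<^sup>2 / a\<^sup>2] (q\<^sup>2))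
      + (a\<^sup>2 - k) * (a - k\<^sup>2) / ((1 - a) * (1 - k) * (a\<^sup>2 - k\<^sup>2))"
proof -
  define p where "p = q\<^sup>2"
  have q: "norm q < 1" "norm q < norm (a / k)" "norm q < norm (k / a)"
    using assms(4) by auto
  have p: "norm p < 1" "p \<noteq> 0" using power2_norm_less_1[OF q(1)] \<open>q \<noteq> 0\<close> by (simp_all add: p_def)
  note nz = \<open>a \<noteq> 0\<close> \<open>k \<noteq> 0\<close> \<open>q \<noteq> 0\<close>
  have nz_aq: "qpoch_inf (a * q) q \<noteq> 0" "qpoch_inf (1 / a * q) q \<noteq> 0"
    using assms(7,8) unfolding WP_Bailey_denoms_nonzero_def by (intro qpoch_inf_nonzeroI q; blast)+
  have params: "wp_parameters a k q"
  proof
    show "qpoch_inf (k * q) q \<noteq> 0" "qpoch_inf (k\<^sup>2 * q / a) (q\<^sup>2) \<noteq> 0"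
      using assms(9) p(1) unfolding F_denoms_nonzero_def qpochs_def p_def
      by (intro qpoch_inf_nonzeroI q; auto)+
  qed (use nz q nz_aq assms(9) in \<open>auto simp: F_denoms_nonzero_def\<close>)
  have params': "wp_parameters (1 / a) (1 / k) q"
  proof
    show "qpoch_inf (1 / k * q) q \<noteq> 0" "qpoch_inf ((1 / k)\<^sup>2 * q / (1 / a)) (q\<^sup>2) \<noteq> 0"
      using assms(10) p(1) unfolding F_denoms_nonzero_def qpochs_def p_def
      by (intro qpoch_inf_nonzeroI q; auto)+
    show "1 - 1 / k \<noteq> 0" using assms(10) by (simp add: F_denoms_nonzero_def)
    show "norm q < norm (1 / k / (1 / a))" using q by simp
  qed (use nz q nz_aq in auto)
  define X where "X = a\<^sup>2 / k\<^sup>2"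
  have F1: "F \<alpha> \<beta> a k q = qlambert (k * q) q + qlambert q p + qlambert (X * p) p
     - qlambert (a * p) p - qlambert (a / k * q) q - qlambert (k\<^sup>2 * q / a) p"
    using wp_parameters.F_eq_qlambert[OF params assms(5) assms(14)] by (simp add: X_def p_def mult_ac)
  \<comment> \<open>The arguments are written as \<open>q / x\<close> or \<open>p / x\<close> to be
    paired with \<open>F1\<close> in \<open>qzeta\<close>; \<open>qlambert q p\<close> occurs in
    both and cancels.\<close>
  have F2: "F \<alpha> \<beta> (1 / a) (1 / k) q = qlambert (q / k) q + qlambert q p + qlambert (p / X) p
     - qlambert (p / a) p - qlambert (q / (a / k)) q - qlambert (p / (k\<^sup>2 * q / a)) p"
  proof -
    have e: "1 / k * q = q / k" "q\<^sup>2 * (1 / a)\<^sup>2 / (1 / k)\<^sup>2 = p / X" "q\<^sup>2 * (1 / a) = p / a"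
      "q * (1 / a) / (1 / k) = q / (a / k)" "(1 / k)\<^sup>2 * q / (1 / a) = p / (k\<^sup>2 * q / a)"
      using nz by (simp_all add: X_def p_def power2_eq_square)
    show ?thesis
      using wp_parameters.F_eq_qlambert[OF params' assms(6) assms(15)] unfolding e unfolding p_def .
  qed

  have nz11: "qpoch_inf (a * q / k\<^sup>2) p \<noteq> 0" "qpoch_inf (k\<^sup>2 * q / a) p \<noteq> 0" "qpoch_inf a p \<noteq> 0"
    "qpoch_inf (p / a) p \<noteq> 0" "qpoch_inf (k\<^sup>2) p \<noteq> 0" "qpoch_inf (p / k\<^sup>2) p \<noteq> 0" "qpoch_inf q p \<noteq> 0"
    using assms(11) by (simp_all add: qpochs_inf_def p_def)
  have nz12: "qpoch_inf X p \<noteq> 0" "qpoch_inf (p * k\<^sup>2 / a\<^sup>2) p \<noteq> 0"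
    using assms(12) by (simp_all add: qpochs_inf_def p_def X_def)
  have args: "p / (a * q) = q / a" "p / (k\<^sup>2 / a) = q\<^sup>2 * a / k\<^sup>2" "p / (k\<^sup>2 / q) = q ^ 3 / k\<^sup>2"
    "p / (k\<^sup>2 * q / a) = a * q / k\<^sup>2" "p / q = q" "p / X = p * k\<^sup>2 / a\<^sup>2"
    using nz by (simp_all add: p_def X_def power2_eq_square power3_eq_cube)
  have th: "qtheta (k\<^sup>2 * q / a) p \<noteq> 0" "qtheta a p \<noteq> 0" "qtheta (k\<^sup>2) p \<noteq> 0" "qtheta q p \<noteq> 0" "qtheta X p \<noteq> 0"
    unfolding qtheta_def args using nz11 nz12 by simp_all
  have th_k: "qtheta k q \<noteq> 0" "qtheta (- k) q \<noteq> 0"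
    using qtheta_square[OF q(1), of k] th(3) by (auto simp: p_def)
  have X2: "(a / k)\<^sup>2 = X" by (simp add: X_def power_divide)
  have th_ak: "qtheta (a / k) q \<noteq> 0" "qtheta (- (a / k)) q \<noteq> 0"
    using qtheta_square[OF q(1), of "a / k"] th(5) by (auto simp: p_def X2)

  have th_inv_q: "qtheta (1 / q) p = - qtheta q p / q"
    by (rule qtheta_inverse[OF p(1)]) (use nz in auto)
  have th_aq: "qtheta (a * q) p = - qtheta (a / q) p / (a / q)"
    using qtheta_times_q[OF p, of "a / q"] nz by (simp add: p_def power2_eq_square mult_ac)
  have th_kkq: "qtheta (k\<^sup>2 * q) p = - qtheta (k\<^sup>2 / q) p / (k\<^sup>2 / q)"
    using qtheta_times_q[OF p, of "k\<^sup>2 / q"] nz by (simp add: p_def power2_eq_square mult_ac)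
  have th_aq_nz: "qtheta (a * q) p \<noteq> 0"
    using nz_aq qpoch_inf_double[OF q(1), of "a * q"] qpoch_inf_double[OF q(1), of "1 / a * q"]
    unfolding qtheta_def args by (simp add: p_def)
  hence th_a_q: "qtheta (a * (1 / q)) p \<noteq> 0" using th_aq nz by auto

  define G1 where "G1 = a * q / k\<^sup>2 *
        (qpochs_inf [a * q, q / a, k\<^sup>2 / a, q\<^sup>2 * a / k\<^sup>2, k\<^sup>2 / q, q ^ 3 / k\<^sup>2, q\<^sup>2, q\<^sup>2] (q\<^sup>2) /
         qpochs_inf [a * q / k\<^sup>2, k\<^sup>2 * q / a, a, q\<^sup>2 / a, k\<^sup>2, q\<^sup>2 / k\<^sup>2, q, q] (q\<^sup>2))"
  define G2 where "G2 = a / k *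
        (qpochs_inf [k\<^sup>2 / a, q * a / k\<^sup>2, - a, - q / a] q * qpochs_inf [q\<^sup>2, q\<^sup>2] (q\<^sup>2) /
         qpochs_inf [k\<^sup>2, q\<^sup>2 / k\<^sup>2, a\<^sup>2 / k\<^sup>2, q\<^sup>2 * k\<^sup>2 / a\<^sup>2] (q\<^sup>2))"
  have G1: "G1 = a * q / k\<^sup>2 * (qtheta (a * q) p * qtheta (k\<^sup>2 / a) p * qtheta (k\<^sup>2 / q) p * (qpoch_inf p p)\<^sup>2 /
     (qtheta (k\<^sup>2 * q / a) p * qtheta a p * qtheta (k\<^sup>2) p * qtheta q p))"
    unfolding G1_def qtheta_def args qpochs_inf_def power2_eq_square[of "qpoch_inf p p"]
    by (simp add: p_def mult_ac)
  have G2: "G2 = a / k * (qtheta (k\<^sup>2 / a) q * qtheta (- a) q * (qpoch_inf p p)\<^sup>2 / (qtheta (k\<^sup>2) p * qtheta X p))"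
  proof -
    have "q / (k\<^sup>2 / a) = q * a / k\<^sup>2" "q / - a = - q / a" by simp_all
    thus ?thesis
      unfolding G2_def qtheta_def args qpochs_inf_def power2_eq_square[of "qpoch_inf p p"]
      by (simp add: p_def X_def mult_ac)
  qed

  have "qzeta (k\<^sup>2 * q / a) p - qzeta (k\<^sup>2) p + qzeta a p = - G1"
  proof -
    have e: "k\<^sup>2 * q / a * a * (1 / q) = k\<^sup>2" "k\<^sup>2 * q / a * a = k\<^sup>2 * q" "k\<^sup>2 * q / a * (1 / q) = k\<^sup>2 / a"
      using nz by simp_all
    \<comment> \<open>With \<open>z = 1 / q\<close> the product \<open>x y z\<close> is
      \<open>k^2\<close>, and one zeta value becomes constant.\<close>
    have four: "qzeta (k\<^sup>2 * q / a) p - qzeta (k\<^sup>2) p + qzeta (1 / q) p - qzeta (1 / a) p =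
     (qpoch_inf p p)\<^sup>2 * qtheta (k\<^sup>2 * q) p * qtheta (k\<^sup>2 / a) p * qtheta (a * (1 / q)) p /
     (qtheta (k\<^sup>2 * q / a) p * qtheta a p * qtheta (1 / q) p * qtheta (k\<^sup>2) p)"
      using qzeta_four_term[OF p, of "k\<^sup>2 * q / a" a "1 / q", unfolded e] nz th th_a_q th_inv_q by simp
    \<comment> \<open>\<open>q\<close> is fixed by x |-> p / x, so \<open>qzeta q p = 0\<close> and
      only the constant of the inversion formula remains.\<close>
    have "qzeta (1 / q) p = - 1"
      using qzeta_inverse[OF p \<open>q \<noteq> 0\<close> th(4)] by (simp add: qzeta_def args)
    moreover have "qzeta (1 / a) p = - qzeta a p - 1"
      by (rule qzeta_inverse[OF p \<open>a \<noteq> 0\<close> th(2)])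
    moreover have "(qpoch_inf p p)\<^sup>2 * qtheta (k\<^sup>2 * q) p * qtheta (k\<^sup>2 / a) p * qtheta (a * (1 / q)) p /
     (qtheta (k\<^sup>2 * q / a) p * qtheta a p * qtheta (1 / q) p * qtheta (k\<^sup>2) p) = - G1"
      unfolding G1 th_kkq th_aq th_inv_q using nz by (simp add: mult_ac power2_eq_square)
    ultimately show ?thesis using four by (simp add: add_diff_eq diff_add_eq)
  qed
  moreover have "qzeta (- (a / k)) q - qzeta (a / k) q - qzeta (- k) q + qzeta k q = - (2 * G2)"
  proof -
    have e: "- (a / k) * k * (- 1 / k) = a / k" "- (a / k) * k = - a" "- (a / k) * (- 1 / k) = 1 / (k\<^sup>2 / a)"
      "k * (- 1 / k) = - 1"
      using nz by (simp_all add: power2_eq_square)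
    \<comment> \<open>Here \<open>y z = - 1\<close>; the 2 in this theta value is the 2 in front of
      \<open>G2\<close>.\<close>
    have m1: "qtheta (- 1) q = 2 * (qpoch_inf (- q) q)\<^sup>2"
      using qpoch_inf_Suc[OF q(1), of "- 1"] by (simp add: qtheta_def power2_eq_square)
    have m1_nz: "qtheta (- 1) q \<noteq> 0"
      unfolding m1 using qpoch_inf_nonzero_norm[OF q(1), of "- q"] q by simp
    have mk: "qtheta (- 1 / k) q = qtheta (- k) q / k"
      using qtheta_inverse[OF q(1), of "- k"] nz by simp
    have four: "qzeta (- (a / k)) q - qzeta (a / k) q + qzeta (- 1 / k) q - qzeta (1 / k) q =
     (qpoch_inf q q)\<^sup>2 * qtheta (- a) q * qtheta (1 / (k\<^sup>2 / a)) q * qtheta (- 1) q /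
     (qtheta (- (a / k)) q * qtheta k q * qtheta (- 1 / k) q * qtheta (a / k) q)"
      using qzeta_four_term[OF q(1) nz(3), of "- (a / k)" k "- 1 / k", unfolded e] nz th_k th_ak m1_nz mk by simp
    have "qzeta (- 1 / k) q = - qzeta (- k) q - 1"
      using qzeta_inverse[OF q(1) nz(3), of "- k"] nz th_k by simp
    moreover have "qzeta (1 / k) q = - qzeta k q - 1"
      by (rule qzeta_inverse[OF q(1) nz(3) nz(2) th_k(1)])
    moreover have "(qpoch_inf q q)\<^sup>2 * qtheta (- a) q * qtheta (1 / (k\<^sup>2 / a)) q * qtheta (- 1) q /
     (qtheta (- (a / k)) q * qtheta k q * qtheta (- 1 / k) q * qtheta (a / k) q) = - (2 * G2)"
    proof -
      have 1: "qtheta (1 / (k\<^sup>2 / a)) q = - qtheta (k\<^sup>2 / a) q / (k\<^sup>2 / a)"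
        by (rule qtheta_inverse[OF q(1)]) (use nz in auto)
      have 2: "qpoch_inf p p = qpoch_inf q q * qpoch_inf (- q) q"
        using qpoch_inf_square[OF q(1), of q] by (simp add: p_def)
      have 3: "qtheta (k\<^sup>2) p = qtheta k q * qtheta (- k) q" "qtheta X p = qtheta (a / k) q * qtheta (- (a / k)) q"
        using qtheta_square[OF q(1), of k] qtheta_square[OF q(1), of "a / k"] by (simp_all add: p_def X2)
      show ?thesis
        unfolding G2 1 2 3 m1 mk using nz by (simp add: power2_eq_square mult_ac)
    qed
    ultimately show ?thesis using four by (simp add: add_diff_eq diff_add_eq)
  qed
  moreover have "qzeta k q + qzeta (- k) q = 2 * qzeta (k\<^sup>2) p"
    using qzeta_square[OF q(1), of k] th(3) by (simp add: p_def)
  moreover have "qzeta (a / k) q + qzeta (- (a / k)) q = 2 * qzeta X p"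
    using qzeta_square[OF q(1), of "a / k"] th(5) by (simp add: p_def X2)
  \<comment> \<open>The base-\<open>q\<close> identity is halved; duplication replaces
    \<open>qzeta (k^2) p\<close> and \<open>qzeta X p\<close> by half-sums over \<open>k\<close>,
    \<open>- k\<close> and \<open>a / k\<close>, \<open>- (a / k)\<close>.\<close>
  ultimately have "qzeta k q + qzeta X p - qzeta a p - qzeta (a / k) q - qzeta (k\<^sup>2 * q / a) p = G1 - G2"
    by algebra
  moreover have "qzeta k q = k / (1 - k) + qlambert (k * q) q - qlambert (q / k) q"
    using th_k by (intro qzeta_Suc q) (auto simp: qtheta_def)
  moreover have "qzeta X p = X / (1 - X) + qlambert (X * p) p - qlambert (p / X) p"
    by (intro qzeta_Suc p nz12)
  moreover have "qzeta a p = a / (1 - a) + qlambert (a * p) p - qlambert (p / a) p"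
    by (intro qzeta_Suc p nz11)
  moreover have "qzeta (a / k) q = (a / k) / (1 - a / k) + qlambert (a / k * q) q - qlambert (q / (a / k)) q"
    using th_ak by (intro qzeta_Suc q) (auto simp: qtheta_def)
  \<comment> \<open>Four initial terms enter; \<open>k^2 q / a\<close> needs none, because its
    Lambert series appears unshifted in \<open>F1\<close>.\<close>
  moreover have "a / (1 - a) + (a / k) / (1 - a / k) - k / (1 - k) - X / (1 - X) =
      (a\<^sup>2 - k) * (a - k\<^sup>2) / ((1 - a) * (1 - k) * (a\<^sup>2 - k\<^sup>2))"
  proof -
    have d: "1 - a \<noteq> 0" "1 - k \<noteq> 0" "k - a \<noteq> 0" "k + a \<noteq> 0"
      using assms(13) by (auto simp: power2_eq_square square_diff_square_factored add.commute)
    have 1: "(a / k) / (1 - a / k) = a / (k - a)"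
      using nz d by (simp add: divide_simps)
    have 2: "X / (1 - X) = a\<^sup>2 / ((k - a) * (k + a))"
    proof -
      have "1 - X = (k - a) * (k + a) / k\<^sup>2"
        using nz by (simp add: X_def divide_simps) (simp add: algebra_simps power2_eq_square)
      thus ?thesis using nz by (simp add: X_def)
    qed
    have 3: "a\<^sup>2 - k\<^sup>2 = - ((k - a) * (k + a))" by (simp add: algebra_simps power2_eq_square)
    show ?thesis
      unfolding 1 2 3 using d by (simp add: divide_simps) algebra
  qed
  ultimately show ?thesis
    unfolding F1 F2 G1_def[symmetric] G2_def[symmetric] qzeta_def[of "k\<^sup>2 * q / a"] by algebra
qed

end
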